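(* Let $p>0$ be real. The maximum $p$-mean clique partition problem can be solved exactly in $O(n^3)$ time on interval graphs with $n$ vertices.
   Context: Given a simple undirected graph $G=(V,E)$ with $n$ vertices, a clique partition is a partition of $V$ into cliques of $G$. For $v\in V$, let $a_v$ be the size of the clique of the partition containing $v$. The maximum $p$-mean clique partition problem asks for a clique partition maximizing $\left(\frac1n\sum_{v\in V}a_v^p\right)^{1/p}$. *)

theory Defs
  imports Complex_Main "HOL-Library.Disjoint_Sets" "HOL-Library.Ramsey"
    "HOL-Library.Landau_Symbols"
begin

definition simple_graph :: "'a set \<Rightarrow> 'a set set \<Rightarrow> bool" where
  "simple_graph V E \<longleftrightarrow> finite V \<and> E \<subseteq> [V]\<^bsup>2\<^esup>"

definition interval_graph :: "'a set \<Rightarrow> 'a set set \<Rightarrow> bool" where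
  "interval_graph V E \<longleftrightarrow> simple_graph V E \<and>
     (\<exists>l r :: 'a \<Rightarrow> real. (\<forall>v\<in>V. l v \<le> r v) \<and>
       (\<forall>u\<in>V. \<forall>v\<in>V. u \<noteq> v \<longrightarrow>
          ({u, v} \<in> E \<longleftrightarrow> {l u..r u} \<inter> {l v..r v} \<noteq> {})))"

definition clique_partition :: "'a set \<Rightarrow> 'a set set \<Rightarrow> 'a set set \<Rightarrow> bool" where
  "clique_partition V E P \<longleftrightarrow> partition_on V P \<and> (\<forall>C\<in>P. clique C E)"

definition block_size :: "'a set set \<Rightarrow> 'a \<Rightarrow> nat" where
  "block_size P v = card (THE C. C \<in> P \<and> v \<in> C)"

definition p_mean :: "real \<Rightarrow> 'a set \<Rightarrow> 'a set set \<Rightarrow> real" where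
  "p_mean p V P =
     ((1 / real (card V)) * (\<Sum>v\<in>V. real (block_size P v) powr p)) powr (1 / p)"

definition max_p_mean_clique_partition ::
    "real \<Rightarrow> 'a set \<Rightarrow> 'a set set \<Rightarrow> 'a set set \<Rightarrow> bool" where
  "max_p_mean_clique_partition p V E P \<longleftrightarrow> clique_partition V E P \<and>
     (\<forall>Q. clique_partition V E Q \<longrightarrow> p_mean p V Q \<le> p_mean p V P)"

text \<open>
  Structured programs for a unit-cost real RAM. The memory consists of arrays of natural numbers
  and arrays of real numbers; a scalar variable is an array of which only cell 0 is used.
  A program mentions only finitely many array names, but array indices are computed at run
  time (indirect addressing). Naturals support only addition and truncated subtraction, so that
  unit cost cannot be exploited by multiplying huge integers. Reals support field
  arithmetic and powers. Natural numbers can be cast to reals, but a real can influence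
  natural-number memory only through comparisons (there is no rounding), and the only constants
  in a program are natural numbers.
\<close>

datatype nexp =
    NConst nat
  | NGet nat nexp
  | NAdd nexp nexp
  | NSub nexp nexp

datatype rexp =
    RNat nexp
  | RGet nat nexp
  | RAdd rexp rexp
  | RSub rexp rexp
  | RMul rexp rexp
  | RDiv rexp rexp
  | RPow rexp rexp

datatype bexp =
    NLess nexp nexp
  | RLess rexp rexp
  | Neg bexp
  | Conj bexp bexp

datatype com =
    Skip
  | NSet nat nexp nexp
  | RSet nat nexp rexp
  | Seq com com
  | Cond bexp com com
  | Loop bexp com

record store =
  nmem :: "nat \<Rightarrow> nat \<Rightarrow> nat"
  rmem :: "nat \<Rightarrow> nat \<Rightarrow> real"

primrec nval :: "store \<Rightarrow> nexp \<Rightarrow> nat" where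
  "nval s (NConst k) = k"
| "nval s (NGet x e) = nmem s x (nval s e)"
| "nval s (NAdd a b) = nval s a + nval s b"
| "nval s (NSub a b) = nval s a - nval s b"

primrec rval :: "store \<Rightarrow> rexp \<Rightarrow> real" where
  "rval s (RNat e) = real (nval s e)"
| "rval s (RGet x e) = rmem s x (nval s e)"
| "rval s (RAdd a b) = rval s a + rval s b"
| "rval s (RSub a b) = rval s a - rval s b"
| "rval s (RMul a b) = rval s a * rval s b"
| "rval s (RDiv a b) = rval s a / rval s b"
| "rval s (RPow a b) = rval s a powr rval s b"

primrec bval :: "store \<Rightarrow> bexp \<Rightarrow> bool" where
  "bval s (NLess a b) \<longleftrightarrow> nval s a < nval s b"
| "bval s (RLess a b) \<longleftrightarrow> rval s a < rval s b"
| "bval s (Neg b) \<longleftrightarrow> \<not> bval s b"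
| "bval s (Conj a b) \<longleftrightarrow> bval s a \<and> bval s b"

definition nupd :: "nat \<Rightarrow> nat \<Rightarrow> nat \<Rightarrow> store \<Rightarrow> store" where
  "nupd x i k s = s\<lparr>nmem := (nmem s)(x := (nmem s x)(i := k))\<rparr>"

definition rupd :: "nat \<Rightarrow> nat \<Rightarrow> real \<Rightarrow> store \<Rightarrow> store" where
  "rupd x i r s = s\<lparr>rmem := (rmem s)(x := (rmem s x)(i := r))\<rparr>"

text \<open>
  \<open>exec c s t s'\<close>: started in \<open>s\<close>, program \<open>c\<close> halts in \<open>s'\<close> after \<open>t\<close> steps.
  One step is charged per assignment and per evaluation of a guard: the expressions
  of a fixed program have constant size, so this agrees up to a constant factor with charging
  every single operation.
\<close>

inductive exec :: "com \<Rightarrow> store \<Rightarrow> nat \<Rightarrow> store \<Rightarrow> bool" where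
  Skip: "exec Skip s 1 s"
| NSet: "exec (NSet x i e) s 1 (nupd x (nval s i) (nval s e) s)"
| RSet: "exec (RSet x i e) s 1 (rupd x (nval s i) (rval s e) s)"
| Seq: "exec c s t s' \<Longrightarrow> exec d s' u s'' \<Longrightarrow> exec (Seq c d) s (t + u) s''"
| CondTrue: "bval s b \<Longrightarrow> exec c s t s' \<Longrightarrow> exec (Cond b c d) s (1 + t) s'"
| CondFalse: "\<not> bval s b \<Longrightarrow> exec d s t s' \<Longrightarrow> exec (Cond b c d) s (1 + t) s'"
| LoopFalse: "\<not> bval s b \<Longrightarrow> exec (Loop b c) s 1 s"
| LoopTrue: "bval s b \<Longrightarrow> exec c s t s' \<Longrightarrow> exec (Loop b c) s' u s'' \<Longrightarrow>
    exec (Loop b c) s (1 + t + u) s''"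

inductive_cases exec_SkipE: "exec Skip s t s'"
inductive_cases exec_NSetE: "exec (NSet x i e) s t s'"
inductive_cases exec_RSetE: "exec (RSet x i e) s t s'"
inductive_cases exec_SeqE: "exec (Seq c d) s t s'"
inductive_cases exec_CondE: "exec (Cond b c d) s t s'"
inductive_cases exec_LoopE: "exec (Loop b c) s t s'"

lemma exec_deterministic:
  "exec c s t s' \<Longrightarrow> exec c s u s'' \<Longrightarrow> u = t \<and> s'' = s'"
proof (induction arbitrary: u s'' rule: exec.induct)
  case (Skip s)
  then show ?case by (rule exec_SkipE) simp
next
  case (NSet x i e s)
  then show ?case by (rule exec_NSetE) simp
next
  case (RSet x i e s)
  then show ?case by (rule exec_RSetE) simp
next
  case (Seq c s t s' d v s2)
  from Seq.prems show ?case
  proof (rule exec_SeqE)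
    fix t1 s1 t2
    assume "u = t1 + t2" "exec c s t1 s1" "exec d s1 t2 s''"
    with Seq.IH(1)[of t1 s1] Seq.IH(2)[of t2 s''] show ?thesis by simp
  qed
next
  case (CondTrue s b c t s' d)
  from CondTrue.prems show ?case
  proof (rule exec_CondE)
    fix t1 assume "u = Suc t1" "exec c s t1 s''"
    with CondTrue.IH[of t1 s''] show ?thesis by simp
  qed (simp add: CondTrue.hyps)
next
  case (CondFalse s b d t s' c)
  from CondFalse.prems show ?case
  proof (rule exec_CondE)
    fix t1 assume "u = Suc t1" "exec d s t1 s''"
    with CondFalse.IH[of t1 s''] show ?thesis by simp
  qed (simp add: CondFalse.hyps)
next
  case (LoopFalse s b c)
  from LoopFalse.prems show ?case
    by (rule exec_LoopE) (simp_all add: LoopFalse.hyps)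
next
  case (LoopTrue s b c t s' v s2)
  from LoopTrue.prems show ?case
  proof (rule exec_LoopE)
    fix t1 s1 t2
    assume "u = Suc (t1 + t2)" "exec c s t1 s1" "exec (Loop b c) s1 t2 s''"
    with LoopTrue.IH(1)[of t1 s1] LoopTrue.IH(2)[of t2 s''] show ?thesis by simp
  qed (simp add: LoopTrue.hyps)
qed

text \<open>
  Input: the number \<open>n\<close> of vertices in natural array 0, the adjacency matrix (row by row) of a
  graph on \<open>{..<n}\<close> in natural array 1, and the parameter \<open>p\<close> in real array 0. All other
  cells are 0. In particular no interval representation is supplied.
\<close>

definition input_store :: "real \<Rightarrow> nat \<Rightarrow> nat set set \<Rightarrow> store" where
  "input_store p n E =
     \<lparr>nmem = (\<lambda>x i. if x = 0 \<and> i = 0 then n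
                    else if x = 1 \<and> i < n * n \<and> {i div n, i mod n} \<in> E then 1 else 0),
      rmem = (\<lambda>x i. if x = 0 \<and> i = 0 then p else 0)\<rparr>"

text \<open>
  Output: a vertex labelling in natural array 2, denoting the partition into the nonempty sets of
  equally labelled vertices.
\<close>

definition output_partition :: "nat \<Rightarrow> store \<Rightarrow> nat set set" where
  "output_partition n s = (\<lambda>v. {u. u < n \<and> nmem s 2 u = nmem s 2 v}) ` {..<n}"

text \<open>
  \<open>solvable_in_time Class Sol p f\<close>: some program computes, for every simple graph in the class
  \<open>Class\<close>, a vertex partition satisfying \<open>Sol\<close>, and its worst-case running time on graphs with
  \<open>n\<close> vertices is \<open>O(f n)\<close>.
\<close>

definition solvable_in_time ::
    "(nat set \<Rightarrow> nat set set \<Rightarrow> bool) \<Rightarrow>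
     (nat set \<Rightarrow> nat set set \<Rightarrow> nat set set \<Rightarrow> bool) \<Rightarrow>
     real \<Rightarrow> (nat \<Rightarrow> real) \<Rightarrow> bool" where
  "solvable_in_time Class Sol p f \<longleftrightarrow>
     (\<exists>c. \<exists>T :: nat \<Rightarrow> nat. (\<lambda>n. real (T n)) \<in> O(f) \<and>
        (\<forall>n E. simple_graph {..<n} E \<and> Class {..<n} E \<longrightarrow>
           (\<exists>t s. exec c (input_store p n E) t s \<and> t \<le> T n \<and>
                  Sol {..<n} E (output_partition n s))))"

end

theory Submission
  imports Defs
begin

text \<open>
  A graph is an interval graph only if its non-edges can be oriented transitively, and since it has
  no induced 4-cycle every such orientation is an interval order. The orientation is found by
  repeatedly orienting the lexicographically smallest undecided non-edge upwards and propagating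
  to the arcs forced by it; each arc is processed once, in linear time. Counting predecessors in
  the interval order gives intervals with end points in \<open>{0..n}\<close>.

  Cliques correspond to sets of intervals with a common point. Since \<open>x powr (p + 1)\<close> is
  strictly convex, in an optimal assignment of points to the intervals lying inside a window
  \<open>[i, j)\<close> the most popular point \<open>k\<close> is assigned to every interval containing it, and the
  remaining intervals lie inside \<open>[i, k)\<close> or \<open>[k + 1, j)\<close>. This yields a dynamic program over
  \<open>O(n\<^sup>2)\<close> windows with \<open>O(n)\<close> choices of \<open>k\<close> each.
\<close>

section \<open>Lexicographic transitive orientations\<close>

text \<open>No representation is supplied, so the points that cliques can share have to be recovered
  from adjacency alone. Forcing fixes the direction of an arc only relative to its own class, and
  the classes cannot be oriented independently: in an edgeless graph every arc forces only itself,
  and three careless choices make a cyclic triangle. Seeding with the lexicographically smallest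
  undecided non-edge coordinates the classes without recomputing them on what remains. The exponent
  \<open>p + 1\<close> arises because a clique of size \<open>m\<close> contributes \<open>m\<close>
  equal summands \<open>m powr p\<close>. Two points keep the time cubic. The arc queue is never
  reset, so the whole propagation is charged to at most \<open>n * n\<close> arcs. The number of
  intervals of a window that contain \<open>k\<close> depends on three parameters and would be too
  expensive to recount for each triple, but it is a difference of entries of a table with
  two.\<close>

inductive forces :: "('a \<Rightarrow> 'a \<Rightarrow> bool) \<Rightarrow> 'a \<times> 'a \<Rightarrow> 'a \<times> 'a \<Rightarrow> bool" for N where
  tail: "N a b \<Longrightarrow> N c b \<Longrightarrow> \<not> N a c \<Longrightarrow> forces N (a, b) (c, b)"
| head: "N a b \<Longrightarrow> N a c \<Longrightarrow> \<not> N b c \<Longrightarrow> forces N (a, b) (a, c)"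

lemma forces_sym: "forces N x y \<Longrightarrow> symp N \<Longrightarrow> forces N y x"
  by (auto elim!: forces.cases intro!: forces.intros dest: sympD)

lemma forces_swap: "forces N x y \<Longrightarrow> symp N \<Longrightarrow> forces N (prod.swap x) (prod.swap y)"
  by (auto elim!: forces.cases intro!: forces.intros dest: sympD)

lemma forces_rtranclp_sym: "(forces N)\<^sup>*\<^sup>* x y \<Longrightarrow> symp N \<Longrightarrow> (forces N)\<^sup>*\<^sup>* y x"
  by (induction rule: rtranclp_induct) (auto intro: converse_rtranclp_into_rtranclp forces_sym)

lemma forces_rtranclp_swap:
  "(forces N)\<^sup>*\<^sup>* x y \<Longrightarrow> symp N \<Longrightarrow> (forces N)\<^sup>*\<^sup>* (prod.swap x) (prod.swap y)"
  by (induction rule: rtranclp_induct) (auto intro: rtranclp.rtrancl_into_rtrancl forces_swap)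

lemma forces_rtranclp_closed:
  assumes "(forces N)\<^sup>*\<^sup>* x y" "x \<in> D" "\<And>x y. x \<in> D \<Longrightarrow> forces N x y \<Longrightarrow> y \<in> D"
  shows "y \<in> D"
  using assms(1,2) by (induction rule: rtranclp_induct) (auto intro: assms(3))

lemma forces_rtranclp_dom:
  "(forces N)\<^sup>*\<^sup>* x y \<Longrightarrow> N (fst x) (snd x) \<Longrightarrow> N (fst y) (snd y)"
  by (induction rule: rtranclp_induct) (auto elim: forces.cases)

text \<open>Gallai's forcing relation is sound: if \<open>T a b\<close> and \<open>N c b\<close>
  hold without \<open>N a c\<close>, then \<open>T b c\<close> would give \<open>T a c\<close> by
  transitivity, hence \<open>N a c\<close>. So one arc fixes the direction of its whole
  class.\<close>

lemma forces_orientation: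
  assumes "(forces N)\<^sup>*\<^sup>* x y" "T (fst x) (snd x)"
    and "\<And>a b. N a b \<longleftrightarrow> T a b \<or> T b a" "transp T"
  shows "T (fst y) (snd y)"
  using assms(1,2)
proof (induction rule: rtranclp_induct)
  case (step y z)
  have "T (fst y) (snd y)" using step by blast
  with step(2) show ?case
    using assms(3) transpD[OF assms(4)] by cases fastforce+
qed

lemma not_forces_swap:
  assumes "N a b" "\<And>a b. N a b \<longleftrightarrow> T a b \<or> T b a" "transp T" "asymp T"
  shows "\<not> (forces N)\<^sup>*\<^sup>* (a, b) (b, a)"
proof
  assume f: "(forces N)\<^sup>*\<^sup>* (a, b) (b, a)"
  have sN: "symp N" using assms(2) by (auto intro: sympI)
  have "(forces N)\<^sup>*\<^sup>* (b, a) (a, b)" using forces_rtranclp_sym[OF f sN] .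
  with f assms show False
    using forces_orientation[of N "(a,b)" "(b,a)" T] forces_orientation[of N "(b,a)" "(a,b)" T]
    by (metis asympD fst_conv snd_conv)
qed

locale closed_orientation =
  fixes N L :: "'a \<Rightarrow> 'a \<Rightarrow> bool"
  assumes sym: "symp N"
    and edge: "L a b \<Longrightarrow> N a b"
    and total: "N a b \<Longrightarrow> L a b \<or> L b a"
    and asym: "L a b \<Longrightarrow> \<not> L b a"
    and closed: "L a b \<Longrightarrow> forces N (a, b) (c, d) \<Longrightarrow> L c d"
begin

text \<open>Golumbic's triangle lemma. Let the side change its tail from \<open>u\<close> to
  \<open>a'\<close>. Without \<open>N c a'\<close> the arc \<open>(a', b')\<close> would force
  \<open>(c, b')\<close>, against \<open>L b' c\<close>. So \<open>N c a'\<close> holds, and now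
  \<open>(c, u)\<close> forces \<open>(c, a')\<close>. A change of head is dual.\<close>

lemma cyclic_triangle_move:
  assumes "(forces N)\<^sup>*\<^sup>* (a, b) (a', b')" "L a b" "L b c" "L c a"
  shows "L a' b' \<and> L b' c \<and> L c a'"
  using assms
proof (induction "(a', b')" arbitrary: a' b' rule: rtranclp_induct)
  case (step y)
  obtain u v where y: "y = (u, v)" by fastforce
  have t: "L u v" "L v c" "L c u" using step y by blast+
  have L': "L a' b'" using closed t(1) step(2) y by blast
  from step(2)[unfolded y] show ?case
  proof cases
    case tail
    have "N c a'"
    proof (rule ccontr)
      assume "\<not> N c a'"
      then have "forces N (a', b') (c, b')"
        using tail t edge sympD[OF sym] by (meson forces.tail)
      then show False using L' closed asym t tail by blast
    qed
    then show ?thesis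
      using L' tail t edge sympD[OF sym] closed forces.head[of N c u a'] by blast
  next
    case head
    have "N b' c"
    proof (rule ccontr)
      assume "\<not> N b' c"
      then have "forces N (a', b') (a', c)"
        using head t edge sympD[OF sym] by (meson forces.head)
      then show False using L' closed asym t head by blast
    qed
    then show ?thesis
      using L' head t edge sympD[OF sym] closed forces.tail[of N v c b'] by blast
  qed
qed blast

end

text \<open>Every class of mutually forcing arcs is oriented according to its lexicographically smallest
  edge. A cyclic triangle containing the smallest edge \<open>{x, y}\<close> of all cyclic triangles then has
  the form \<open>x \<rightarrow> y \<rightarrow> z \<rightarrow> x\<close>, and moving \<open>z \<rightarrow> x\<close> to the smallest edge \<open>x \<rightarrow> w\<close> of its class
  would reverse \<open>x \<rightarrow> y\<close>.\<close>

locale lex_orientation = closed_orientation N L for N L :: "nat \<Rightarrow> nat \<Rightarrow> bool" +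
  assumes lex: "L a b \<Longrightarrow> b < a \<Longrightarrow>
    \<exists>x y. (forces N)\<^sup>*\<^sup>* (a, b) (x, y) \<and> x < y \<and> (x < b \<or> x = b \<and> y < a)"
begin

lemma no_cyclic_triangle:
  assumes "L a b" "L b c" "L c a"
  shows False
proof -
  define P where "P = {(x, y). x < y \<and>
    ((\<exists>c. L x y \<and> L y c \<and> L c x) \<or> (\<exists>c. L y x \<and> L x c \<and> L c y))}"
  have "(min a b, max a b) \<in> P"
    using assms asym by (auto simp: P_def min_def max_def not_le)
      (metis order_less_le)+
  then obtain z where z: "z \<in> P" "\<And>w. (w, z) \<in> less_than <*lex*> less_than \<Longrightarrow> w \<notin> P"
    using wfE_min[OF wf_lex_prod[OF wf_less_than wf_less_than], of _ P] by blast
  obtain x y where xy: "z = (x, y)" by fastforce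
  have least: "(u, v) \<notin> P" if "u < x \<or> u = x \<and> v < y" for u v
    using z(2)[of "(u, v)"] that xy by auto
  have lt: "x < y" using z(1) xy by (auto simp: P_def)
  \<comment> \<open>A downward arc has a smaller upward arc in its class, and moving the triangle
    along the class would put that smaller edge into \<open>P\<close>.\<close>
  have "\<not> L y x"
  proof
    assume yx: "L y x"
    then obtain c where c: "L x c" "L c y" using z(1) xy asym by (auto simp: P_def)
    obtain x' y' where f: "(forces N)\<^sup>*\<^sup>* (y, x) (x', y')" "x' < y'" "x' < x \<or> x' = x \<and> y' < y"
      using lex[OF yx lt] by blast
    then show False using cyclic_triangle_move[OF f(1) yx c] least[OF f(3)] by (auto simp: P_def)
  qed
  then obtain c where c: "L x y" "L y c" "L c x" using z(1) xy by (auto simp: P_def)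
  have "\<not> c < x" using least[of c x] c by (auto simp: P_def)
  moreover have "c \<noteq> x" using c(3) asym by blast
  ultimately have "x < c" by simp
  then obtain x' y' where f: "(forces N)\<^sup>*\<^sup>* (c, x) (x', y')" "x' < y'" "x' < x \<or> x' = x \<and> y' < c"
    using lex[OF c(3)] by blast
  have m: "L x' y'" "L y' y" "L y x'" using cyclic_triangle_move[OF f(1) c(3) c(1) c(2)] by auto
  then have "\<not> x' < x" using f(2) least[of x' y'] by (auto simp: P_def)
  then show False using f(3) m c asym by blast
qed

text \<open>Without \<open>N a c\<close> the arc \<open>(a, b)\<close> would force
  \<open>(c, b)\<close>, against \<open>L b c\<close>; and \<open>L c a\<close> would close a cyclic
  triangle.\<close>

lemma trans: "L a b \<Longrightarrow> L b c \<Longrightarrow> L a c"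
proof -
  assume ab: "L a b" and bc: "L b c"
  have "N a c"
  proof (rule ccontr)
    assume "\<not> N a c"
    then have "forces N (a, b) (c, b)"
      using ab bc edge sympD[OF sym] by (meson forces.tail)
    then show False using ab bc asym closed by blast
  qed
  then show ?thesis using total no_cyclic_triangle ab bc by blast
qed

end

section \<open>Canonical representation of an interval order\<close>

locale interval_order =
  fixes n :: nat and L :: "nat \<Rightarrow> nat \<Rightarrow> bool"
  assumes bounded: "L a b \<Longrightarrow> a < n \<and> b < n"
    and asym: "L a b \<Longrightarrow> \<not> L b a"
    and trans: "L a b \<Longrightarrow> L b c \<Longrightarrow> L a c"
    and two_plus_two_free: "L a b \<Longrightarrow> L c d \<Longrightarrow> L a d \<or> L c b"
begin

text \<open>Predecessor sets in an interval order are nested, so their cardinalities rank them. With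
  \<open>hi\<close> this gives the canonical half-open interval from \<open>lo v\<close> to
  \<open>hi v\<close>.\<close>

definition lo :: "nat \<Rightarrow> nat" where "lo v = card {u. u < n \<and> L u v}"
definition hi :: "nat \<Rightarrow> nat" where "hi v = Min (insert n {lo w | w. w < n \<and> L v w})"

lemma finite_hi: "finite (insert n {lo w | w. w < n \<and> L v w})"
  by simp

lemma hi_le: "hi v \<le> n"
  unfolding hi_def by (rule Min_le[OF finite_hi]) simp

lemma lo_less:
  assumes "L v w"
  shows "lo v < lo w"
proof -
  have "{u. u < n \<and> L u v} \<subseteq> {u. u < n \<and> L u w}" using assms trans by blast
  moreover have "v \<in> {u. u < n \<and> L u w} - {u. u < n \<and> L u v}"
    using assms bounded asym by blast
  ultimately show ?thesis unfolding lo_def by (intro psubset_card_mono) auto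
qed

lemma lo_less_n: "v < n \<Longrightarrow> lo v < n"
proof -
  assume "v < n"
  then have "{u. u < n \<and> L u v} \<subset> {..<n}" using asym by blast
  then show ?thesis unfolding lo_def using psubset_card_mono[of "{..<n}"] by simp
qed

lemma lo_less_hi: "v < n \<Longrightarrow> lo v < hi v"
  unfolding hi_def using finite_hi[of v] lo_less lo_less_n by (subst Min_gr_iff) auto

text \<open>From right to left by monotonicity of the minimum. Conversely, the minimum is attained
  at a successor \<open>w\<close> of \<open>u\<close>; if \<open>L u v\<close> fails, all
  predecessors of \<open>v\<close> precede \<open>w\<close>, and \<open>u\<close> is one more, so
  \<open>lo v < lo w\<close>.\<close>

lemma hi_le_lo_iff:
  assumes "v < n"
  shows "hi u \<le> lo v \<longleftrightarrow> L u v"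
proof
  assume "L u v"
  then show "hi u \<le> lo v" unfolding hi_def using assms by (intro Min_le[OF finite_hi]) auto
next
  assume le: "hi u \<le> lo v"
  have "hi u \<in> insert n {lo w | w. w < n \<and> L u w}"
    unfolding hi_def by (rule Min_in[OF finite_hi]) simp
  then obtain w where w: "w < n" "L u w" "hi u = lo w"
    using le lo_less_n[OF assms] by auto
  show "L u v"
  proof (rule ccontr)
    assume nL: "\<not> L u v"
    then have "{x. x < n \<and> L x v} \<subseteq> {x. x < n \<and> L x w}"
      using two_plus_two_free w(2) by blast
    moreover have "u \<in> {x. x < n \<and> L x w}" using w bounded by blast
    ultimately have "{x. x < n \<and> L x v} \<subset> {x. x < n \<and> L x w}" using nL by blast
    then have "lo v < lo w" unfolding lo_def by (intro psubset_card_mono) auto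
    then show False using le w by simp
  qed
qed

end

section \<open>Stabbing partitions of a family of intervals\<close>

text \<open>By the mean value theorem the two increments are \<open>(p + 1) * z powr p\<close> with
  \<open>z\<close> above \<open>b\<close> and \<open>(p + 1) * y powr p\<close> with
  \<open>y\<close> below \<open>a\<close>. For \<open>a = 1\<close> the point 0 occurs, where only
  continuity is used.\<close>

lemma powr_exchange:
  fixes a b p :: real
  assumes "0 < p" "1 \<le> a" "a \<le> b"
  shows "b powr (p + 1) + a powr (p + 1) < (b + 1) powr (p + 1) + (a - 1) powr (p + 1)"
proof -
  have mvt: "\<exists>z. x < z \<and> z < x + 1 \<and> (x + 1) powr (p + 1) - x powr (p + 1) = (p + 1) * z powr p"
    if "0 \<le> x" for x :: real
  proof -
    have "\<exists>l z. x < z \<and> z < x + 1 \<and> DERIV (\<lambda>y. y powr (p + 1)) z :> l \<and>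
      (x + 1) powr (p + 1) - x powr (p + 1) = (x + 1 - x) * l"
    proof (rule MVT)
      show "continuous_on {x..x + 1} (\<lambda>y. y powr (p + 1))"
        using that assms by (intro continuous_on_powr' continuous_intros) auto
      show "\<And>y. x < y \<Longrightarrow> y < x + 1 \<Longrightarrow> (\<lambda>y. y powr (p + 1)) differentiable (at y)"
        using that has_real_derivative_powr[of _ "p + 1"]
        by (metis le_less_trans real_differentiable_def)
    qed simp
    then obtain l z where z: "x < z" "z < x + 1" "DERIV (\<lambda>y. y powr (p + 1)) z :> l"
      "(x + 1) powr (p + 1) - x powr (p + 1) = l" by auto
    have "l = (p + 1) * z powr p"
      using DERIV_unique[OF z(3)] has_real_derivative_powr[of z "p + 1"] z that by simp
    with z show ?thesis by blast
  qed
  obtain y where y: "a - 1 < y" "y < a" "a powr (p + 1) - (a - 1) powr (p + 1) = (p + 1) * y powr p"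
    using mvt[of "a - 1"] assms by auto
  obtain z where z: "b < z" "(b + 1) powr (p + 1) - b powr (p + 1) = (p + 1) * z powr p"
    using mvt[of b] assms by auto
  have "y powr p < z powr p" using y z assms by (intro powr_less_mono2) auto
  then have "(p + 1) * y powr p < (p + 1) * z powr p" using assms by simp
  then show ?thesis using y z by linarith
qed

lemma finite_attains_max:
  fixes f :: "'a \<Rightarrow> 'b :: linorder"
  assumes "finite S" "S \<noteq> {}"
  obtains x where "x \<in> S" "\<And>y. y \<in> S \<Longrightarrow> f y \<le> f x"
proof -
  have "Max (f ` S) \<in> f ` S" using assms by simp
  then obtain x where "x \<in> S" "f x = Max (f ` S)" by auto
  with that[of x] show thesis using assms(1) by simp
qed

text \<open>For a partition given by labels, this is the sum inside \<open>p_mean\<close>, whose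
  scaling and root are monotone.\<close>

definition fibre_value :: "real \<Rightarrow> ('a \<Rightarrow> 'b) \<Rightarrow> 'a set \<Rightarrow> real" where
  "fibre_value p g S = (\<Sum>v\<in>S. real (card {u \<in> S. g u = g v}) powr p)"

lemma fibre_value_cong: "(\<And>v. v \<in> S \<Longrightarrow> g v = h v) \<Longrightarrow> fibre_value p g S = fibre_value p h S"
  unfolding fibre_value_def by (intro sum.cong arg_cong[where f = "\<lambda>A. real (card A) powr p"]) auto

lemma real_powr_add_one: "real m * real m powr p = real m powr (p + 1)"
  by (cases "m = 0") (auto simp: powr_add)

lemma fibre_value_const:
  "(\<And>v. v \<in> S \<Longrightarrow> g v = c) \<Longrightarrow> fibre_value p g S = real (card S) powr (p + 1)"
proof -
  assume c: "\<And>v. v \<in> S \<Longrightarrow> g v = c"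
  then have "{u \<in> S. g u = g v} = S" if "v \<in> S" for v using that by auto
  then show ?thesis by (simp add: fibre_value_def real_powr_add_one)
qed

lemma fibre_value_Un:
  assumes "finite A" "finite B" "g ` A \<inter> g ` B = {}"
  shows "fibre_value p g (A \<union> B) = fibre_value p g A + fibre_value p g B"
proof -
  have "A \<inter> B = {}" using assms(3) by blast
  moreover have "{u \<in> A \<union> B. g u = g v} = {u \<in> A. g u = g v}" if "v \<in> A" for v
    using assms(3) that by force
  moreover have "{u \<in> A \<union> B. g u = g v} = {u \<in> B. g u = g v}" if "v \<in> B" for v
    using assms(3) that by force
  ultimately show ?thesis
    using assms(1,2) by (simp add: fibre_value_def sum.union_disjoint)
qed

text \<open>Labels in \<open>X\<close> that are not attained contribute
  \<open>0 powr (p + 1) = 0\<close>, so two assignments can be compared over a common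
  \<open>X\<close>.\<close>

lemma fibre_value_sum:
  assumes "finite S" "finite X" "g ` S \<subseteq> X"
  shows "fibre_value p g S = (\<Sum>x\<in>X. real (card {v \<in> S. g v = x}) powr (p + 1))"
proof -
  have "fibre_value p g S = (\<Sum>x\<in>X. \<Sum>v\<in>{v \<in> S. g v = x}. real (card {u \<in> S. g u = g v}) powr p)"
    unfolding fibre_value_def by (rule sum.group[OF assms, symmetric])
  also have "\<dots> = (\<Sum>x\<in>X. \<Sum>v\<in>{v \<in> S. g v = x}. real (card {u \<in> S. g u = x}) powr p)"
    by (intro sum.cong refl) auto
  finally show ?thesis by (simp add: real_powr_add_one)
qed

lemma fibre_value_move_less:
  assumes "finite S" "v \<in> S" "g v \<noteq> k" "0 < p"
    and "card {u \<in> S. g u = g v} \<le> card {u \<in> S. g u = k}"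
  shows "fibre_value p g S < fibre_value p (g(v := k)) S"
proof -
  let ?h = "g(v := k)" and ?c = "\<lambda>g x. real (card {u \<in> S. g u = x}) powr (p + 1)"
  \<comment> \<open>Only the fibres over \<open>k\<close> and \<open>g v\<close> change; the
    remaining labels form \<open>X\<close> and their contributions cancel.\<close>
  define X where "X = g ` S \<union> {k} - {k, g v}"
  have X: "finite X" "k \<notin> X" "g v \<notin> X" using assms(1) by (auto simp: X_def)
  have "g ` S \<subseteq> insert k (insert (g v) X)" "?h ` S \<subseteq> insert k (insert (g v) X)"
    by (auto simp: X_def)
  then have *: "fibre_value p g S = ?c g k + ?c g (g v) + sum (?c g) X"
    "fibre_value p ?h S = ?c ?h k + ?c ?h (g v) + sum (?c ?h) X"
    using fibre_value_sum[OF assms(1), of "insert k (insert (g v) X)"] X assms(3) by auto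
  have "sum (?c ?h) X = sum (?c g) X"
    using X by (intro sum.cong refl arg_cong[where f = "\<lambda>A. real (card A) powr (p + 1)"]) auto
  moreover have "{u \<in> S. ?h u = k} = insert v {u \<in> S. g u = k}" using assms(2) by auto
  then have "card {u \<in> S. ?h u = k} = card {u \<in> S. g u = k} + 1"
    using assms by simp
  moreover have "{u \<in> S. ?h u = g v} = {u \<in> S. g u = g v} - {v}" using assms(3) by auto
  then have "card {u \<in> S. ?h u = g v} = card {u \<in> S. g u = g v} - 1"
    using assms by simp
  moreover have "1 \<le> card {u \<in> S. g u = g v}"
    using assms(1,2) by (auto simp: Suc_le_eq card_gt_0_iff)
  ultimately show ?thesis
    using * powr_exchange[OF assms(4), of "real (card {u \<in> S. g u = g v})" "real (card {u \<in> S. g u = k})"]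
      assms(5) by (simp add: of_nat_diff add.commute)
qed

text \<open>Vertex \<open>v\<close> occupies the points \<open>l v, \<dots>, r v - 1\<close>.\<close>

locale interval_family =
  fixes n :: nat and l r :: "nat \<Rightarrow> nat"
  assumes less: "v < n \<Longrightarrow> l v < r v"
    and le: "v < n \<Longrightarrow> r v \<le> n"
begin

definition bag :: "nat \<Rightarrow> nat \<Rightarrow> nat set" where
  "bag i j = {v. v < n \<and> i \<le> l v \<and> r v \<le> j}"

definition stabbed :: "nat \<Rightarrow> nat \<Rightarrow> nat \<Rightarrow> nat set" where
  "stabbed i j k = {v \<in> bag i j. l v \<le> k \<and> k < r v}"

lemma finite_bag: "finite (bag i j)"
  by (simp add: bag_def)

lemma bag_empty: "j \<le> i \<Longrightarrow> bag i j = {}"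
  using less by (force simp: bag_def)

lemma bag_all: "bag 0 n = {..<n}"
  using le by (auto simp: bag_def)

lemma bag_split: "i \<le> k \<Longrightarrow> k < j \<Longrightarrow> bag i j = stabbed i j k \<union> (bag i k \<union> bag (Suc k) j)"
  using less by (fastforce simp: bag_def stabbed_def)

text \<open>An interval of the window contains \<open>k\<close>, ends by \<open>k\<close> or starts
  after \<open>k\<close>. The truncated subtractions are exact because the three parts are disjoint.
  This gives each count of the recursion in constant time from the table of
  \<open>card (bag i j)\<close>.\<close>

lemma card_stabbed:
  assumes "i \<le> k" "k < j"
  shows "card (stabbed i j k) = card (bag i j) - card (bag i k) - card (bag (Suc k) j)"
proof -
  have disj: "stabbed i j k \<inter> (bag i k \<union> bag (Suc k) j) = {}" "bag i k \<inter> bag (Suc k) j = {}"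
    using less by (fastforce simp: bag_def stabbed_def)+
  have "card (bag i j) = card (stabbed i j k) + (card (bag i k) + card (bag (Suc k) j))"
    unfolding bag_split[OF assms]
    by (subst card_Un_disjoint) (use disj finite_bag in \<open>auto simp: card_Un_disjoint stabbed_def\<close>)
  then show ?thesis by simp
qed

definition stabbing :: "(nat \<Rightarrow> nat) \<Rightarrow> nat set \<Rightarrow> bool" where
  "stabbing g S \<longleftrightarrow> (\<forall>v\<in>S. l v \<le> g v \<and> g v < r v)"

text \<open>Intervals ending by \<open>k\<close> get labels below \<open>k\<close>, those starting
  after \<open>k\<close> get labels above it, so no fibre meets two of the three parts.\<close>

lemma fibre_value_split:
  assumes ik: "i \<le> k" "k < j" and st: "stabbing g (bag i k \<union> bag (Suc k) j)"
    and k: "\<And>v. v \<in> stabbed i j k \<Longrightarrow> g v = k"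
  shows "fibre_value p g (bag i j) = real (card (stabbed i j k)) powr (p + 1) +
    fibre_value p g (bag i k) + fibre_value p g (bag (Suc k) j)"
proof -
  have lt: "g v < k" if "v \<in> bag i k" for v
  proof -
    have "g v < r v" "r v \<le> k" using st that by (auto simp: stabbing_def bag_def)
    then show ?thesis by simp
  qed
  have gt: "k < g v" if "v \<in> bag (Suc k) j" for v
  proof -
    have "l v \<le> g v" "Suc k \<le> l v" using st that by (auto simp: stabbing_def bag_def)
    then show ?thesis by simp
  qed
  have "g ` bag i k \<subseteq> {..<k}" "g ` bag (Suc k) j \<subseteq> {k<..}" "g ` stabbed i j k \<subseteq> {k}"
    using lt gt k by auto
  then have d: "g ` stabbed i j k \<inter> g ` (bag i k \<union> bag (Suc k) j) = {}"
    "g ` bag i k \<inter> g ` bag (Suc k) j = {}"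
    by fastforce+
  have "finite (stabbed i j k)" by (simp add: stabbed_def finite_bag)
  then show ?thesis
    unfolding bag_split[OF ik] using d k finite_bag
    by (simp add: fibre_value_Un fibre_value_const[where c = k])
qed

text \<open>In an assignment of maximal value, the largest fibre cannot be enlarged: moving a vertex to
  it strictly increases the value, by strict convexity of \<open>x \<mapsto> x powr (p + 1)\<close>.\<close>

lemma maximal_stabbing:
  assumes p: "0 < p" and g: "stabbing g (bag i j)" and ne: "bag i j \<noteq> {}"
  obtains h k where "stabbing h (bag i j)" "fibre_value p g (bag i j) \<le> fibre_value p h (bag i j)"
    "i \<le> k" "k < j" "\<And>v. v \<in> stabbed i j k \<Longrightarrow> h v = k"
proof -
  let ?S = "bag i j"
  let ?F = "PiE ?S (\<lambda>v. {l v..<r v})"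
  have "finite ?F" by (intro finite_PiE finite_bag) simp
  moreover have gF: "restrict g ?S \<in> ?F" using g by (auto simp: stabbing_def)
  ultimately obtain h where h: "h \<in> ?F" and max: "\<And>f. f \<in> ?F \<Longrightarrow> fibre_value p f ?S \<le> fibre_value p h ?S"
    using finite_attains_max[of ?F "\<lambda>f. fibre_value p f ?S"] by blast
  have st: "stabbing h ?S" using h by (auto simp: stabbing_def PiE_iff)
  obtain w where w: "w \<in> ?S" "\<And>v. v \<in> ?S \<Longrightarrow> card {u \<in> ?S. h u = h v} \<le> card {u \<in> ?S. h u = h w}"
    using finite_attains_max[OF finite_bag ne, of "\<lambda>v. card {u \<in> ?S. h u = h v}"] by blast
  have "fibre_value p g ?S = fibre_value p (restrict g ?S) ?S" by (rule fibre_value_cong) simp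
  then have "fibre_value p g ?S \<le> fibre_value p h ?S" using max[OF gF] by simp
  moreover have "i \<le> h w" "h w < j" using w(1) st by (force simp: stabbing_def bag_def)+
  moreover have "h v = h w" if v: "v \<in> stabbed i j (h w)" for v
  proof (rule ccontr)
    assume ne: "h v \<noteq> h w"
    have vS: "v \<in> ?S" using v by (simp add: stabbed_def)
    have "h(v := h w) \<in> ?F" using h v by (auto simp: stabbed_def PiE_iff extensional_def)
    then have "fibre_value p (h(v := h w)) ?S \<le> fibre_value p h ?S" by (rule max)
    moreover have "fibre_value p h ?S < fibre_value p (h(v := h w)) ?S"
      by (rule fibre_value_move_less[where g = h, OF finite_bag vS ne p w(2)[OF vS]])
    ultimately show False by simp
  qed
  ultimately show ?thesis using that st by blast
qed

section \<open>Dynamic program over windows\<close>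

function opt :: "real \<Rightarrow> nat \<Rightarrow> nat \<Rightarrow> real" where
  "opt p i j = (if i < j then Max ((\<lambda>k. real (card (stabbed i j k)) powr (p + 1) +
     opt p i k + opt p (Suc k) j) ` {i..<j}) else 0)"
  by auto
termination by (relation "measure (\<lambda>(p, i, j). j - i)") auto

declare opt.simps [simp del]

definition gain :: "real \<Rightarrow> nat \<Rightarrow> nat \<Rightarrow> nat \<Rightarrow> real" where
  "gain p i j k = real (card (stabbed i j k)) powr (p + 1) + opt p i k + opt p (Suc k) j"

lemma opt_empty: "j \<le> i \<Longrightarrow> opt p i j = 0"
  by (simp add: opt.simps)

lemma opt_eq_Max: "i < j \<Longrightarrow> opt p i j = Max (gain p i j ` {i..<j})"
  by (simp add: opt.simps[of p i j] gain_def)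

lemma gain_le_opt: "i \<le> k \<Longrightarrow> k < j \<Longrightarrow> gain p i j k \<le> opt p i j"
  by (auto simp: opt_eq_Max intro!: Max_ge)

text \<open>Splitting at the first point \<open>i\<close> leaves an empty left window, so the bound
  is inherited from \<open>Suc i\<close>. It serves windows without intervals, where there is no
  largest fibre to split at.\<close>

lemma opt_nonneg: "0 \<le> opt p i j"
proof (induction "j - i" arbitrary: i j rule: less_induct)
  case less
  show ?case
  proof (cases "i < j")
    case True
    then have "0 \<le> opt p (Suc i) j" by (intro less) auto
    then show ?thesis
      using True gain_le_opt[of i i j p] opt_empty[of i i p]
        powr_ge_zero[of "real (card (stabbed i j i))" "p + 1"]
      unfolding gain_def by linarith
  qed (simp add: opt_empty)
qed

lemma fibre_value_le_opt:
  assumes p: "0 < p"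
  shows "stabbing g (bag i j) \<Longrightarrow> fibre_value p g (bag i j) \<le> opt p i j"
proof (induction "j - i" arbitrary: i j g rule: less_induct)
  case less
  show ?case
  proof (cases "bag i j = {}")
    case True
    then show ?thesis using opt_nonneg by (simp add: fibre_value_def)
  next
    case False
    obtain h k where h: "stabbing h (bag i j)"
      "fibre_value p g (bag i j) \<le> fibre_value p h (bag i j)"
      "i \<le> k" "k < j" "\<And>v. v \<in> stabbed i j k \<Longrightarrow> h v = k"
      using maximal_stabbing[OF p less.prems False] by blast
    have sub: "stabbing h (bag i k)" "stabbing h (bag (Suc k) j)"
      using h(1) bag_split[OF h(3,4)] by (auto simp: stabbing_def)
    then have "fibre_value p h (bag i j) = real (card (stabbed i j k)) powr (p + 1) +
        fibre_value p h (bag i k) + fibre_value p h (bag (Suc k) j)"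
      using h by (intro fibre_value_split) (auto simp: stabbing_def)
    moreover have "fibre_value p h (bag i k) \<le> opt p i k" "fibre_value p h (bag (Suc k) j) \<le> opt p (Suc k) j"
      using sub h by (auto intro!: less.hyps)
    ultimately show ?thesis using h gain_le_opt[OF h(3,4), of p] by (simp add: gain_def)
  qed
qed

end

text \<open>The choice \<open>ch\<close> is kept arbitrary among the maximisers because it will be
  read off the memory of the machine.\<close>

locale optimal_choice = interval_family +
  fixes p :: real and ch :: "nat \<Rightarrow> nat \<Rightarrow> nat"
  assumes p: "0 < p"
    and ch: "i < j \<Longrightarrow> j \<le> n \<Longrightarrow> i \<le> ch i j \<and> ch i j < j"
    and gain_ch: "i < j \<Longrightarrow> j \<le> n \<Longrightarrow> gain p i j (ch i j) = opt p i j"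
begin

text \<open>The bounds on \<open>k\<close> in the guards make the window shrink for all arguments,
  whereas \<open>ch\<close> is constrained only for \<open>i < j\<close> and
  \<open>j \<le> n\<close>.\<close>

function label :: "nat \<Rightarrow> nat \<Rightarrow> nat \<Rightarrow> nat" where
  "label i j v = (let k = ch i j in
     if i \<le> k \<and> k < j \<and> r v \<le> k then label i k v
     else if i \<le> k \<and> k < j \<and> k < l v then label (Suc k) j v else k)"
  by auto
termination by (relation "measure (\<lambda>(i, j, v). j - i)") auto

declare label.simps [simp del]

lemma label_optimal:
  "j \<le> n \<Longrightarrow> stabbing (label i j) (bag i j) \<and> fibre_value p (label i j) (bag i j) = opt p i j"
proof (induction "j - i" arbitrary: i j rule: less_induct)
  case less
  show ?case
  proof (cases "i < j")
    case False
    then show ?thesis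
      using bag_empty[of j i] opt_empty[of j i p] by (simp add: stabbing_def fibre_value_def)
  next
    case True
    define k where "k = ch i j"
    have k: "i \<le> k" "k < j" using ch[of i j] True less.prems by (auto simp: k_def)
    have IH: "stabbing (label i k) (bag i k)" "fibre_value p (label i k) (bag i k) = opt p i k"
      "stabbing (label (Suc k) j) (bag (Suc k) j)"
      "fibre_value p (label (Suc k) j) (bag (Suc k) j) = opt p (Suc k) j"
      using less.hyps[of k i] less.hyps[of j "Suc k"] k less.prems by auto
    have left: "label i j v = label i k v" if "v \<in> bag i k" for v
      using that k by (subst label.simps) (simp add: k_def[symmetric] bag_def)
    have right: "label i j v = label (Suc k) j v" if v: "v \<in> bag (Suc k) j" for v
    proof -
      have "\<not> r v \<le> k" "k < l v" using interval_family.less[OF interval_family_axioms, of v] v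
        by (auto simp: bag_def)
      then show ?thesis using k by (subst label.simps) (simp add: k_def[symmetric])
    qed
    have mid: "label i j v = k" if "v \<in> stabbed i j k" for v
      using that k by (subst label.simps) (simp add: k_def[symmetric] stabbed_def)
    have st: "stabbing (label i j) (bag i k)" "stabbing (label i j) (bag (Suc k) j)"
      using IH(1,3) left right by (auto simp: stabbing_def)
    moreover have "stabbing (label i j) (stabbed i j k)"
      using mid by (auto simp: stabbing_def stabbed_def)
    ultimately have all: "stabbing (label i j) (bag i j)"
      unfolding bag_split[OF k] by (auto simp: stabbing_def)
    have "fibre_value p (label i j) (bag i j) = real (card (stabbed i j k)) powr (p + 1) +
        fibre_value p (label i j) (bag i k) + fibre_value p (label i j) (bag (Suc k) j)"
      using st mid by (intro fibre_value_split k) (auto simp: stabbing_def)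
    also have "\<dots> = opt p i j"
      using IH(2,4) fibre_value_cong[of "bag i k", OF left] fibre_value_cong[of "bag (Suc k) j", OF right]
        gain_ch[OF True less.prems] by (simp add: k_def gain_def)
    finally show ?thesis using all by blast
  qed
qed

lemma optimal_labelling:
  assumes "stabbing g {..<n}"
  shows "stabbing (label 0 n) {..<n}"
    "fibre_value p g {..<n} \<le> fibre_value p (label 0 n) {..<n}"
  using label_optimal[of n 0] fibre_value_le_opt[OF p, of g 0 n] assms bag_all by auto

end

section \<open>Clique partitions of interval graphs\<close>

definition nonadjacent :: "nat \<Rightarrow> nat set set \<Rightarrow> nat \<Rightarrow> nat \<Rightarrow> bool" where
  "nonadjacent n E a b \<longleftrightarrow> a < n \<and> b < n \<and> a \<noteq> b \<and> {a, b} \<notin> E"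

lemma symp_nonadjacent: "symp (nonadjacent n E)"
  by (auto simp: symp_def nonadjacent_def insert_commute)

text \<open>\<open>T\<close> orders disjoint intervals from left to right. For the last property,
  the smaller of \<open>r a\<close> and \<open>r c\<close> lies to the left of both
  \<open>l b\<close> and \<open>l d\<close>. \<open>T\<close> exists only in the proofs; the program
  never sees it.\<close>

lemma interval_graph_precedence:
  assumes "interval_graph {..<n} E"
  shows "\<exists>T. (\<forall>a b. nonadjacent n E a b \<longleftrightarrow> T a b \<or> T b a) \<and> transp T \<and> asymp T \<and>
    (\<forall>a b c d. T a b \<longrightarrow> T c d \<longrightarrow> T a d \<or> T c b)"
proof -
  obtain l r :: "nat \<Rightarrow> real" where l: "\<forall>v\<in>{..<n}. l v \<le> r v"
    and lr: "\<forall>u\<in>{..<n}. \<forall>v\<in>{..<n}. u \<noteq> v \<longrightarrow> ({u, v} \<in> E \<longleftrightarrow> {l u..r u} \<inter> {l v..r v} \<noteq> {})"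
    using assms unfolding interval_graph_def by blast
  define T where "T a b \<longleftrightarrow> a < n \<and> b < n \<and> r a < l b" for a b
  have lr': "l v \<le> r v" if "v < n" for v using l that by simp
  have irr: "\<not> r v < l v" if "v < n" for v using lr'[OF that] by simp
  have "nonadjacent n E a b \<longleftrightarrow> T a b \<or> T b a" for a b
  proof (cases "a < n \<and> b < n \<and> a \<noteq> b")
    case True
    then show ?thesis
      using lr l by (fastforce simp: nonadjacent_def T_def not_le Int_atLeastAtMost)
  next
    case False
    then show ?thesis using irr by (auto simp: nonadjacent_def T_def)
  qed
  moreover have "transp T"
  proof (rule transpI)
    show "T a c" if "T a b" "T b c" for a b c using that lr'[of b] by (simp add: T_def)
  qed
  moreover have "asymp T"
  proof (rule asympI)
    show "\<not> T b a" if "T a b" for a b using that lr'[of a] lr'[of b] by (simp add: T_def)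
  qed
  moreover have "T a d \<or> T c b" if "T a b" "T c d" for a b c d using that by (auto simp: T_def)
  ultimately show ?thesis by blast
qed

lemma not_forces_swap_interval_graph:
  assumes "interval_graph {..<n} E" "nonadjacent n E a b"
  shows "\<not> (forces (nonadjacent n E))\<^sup>*\<^sup>* (a, b) (b, a)"
proof -
  obtain T where T: "\<forall>a b. nonadjacent n E a b \<longleftrightarrow> T a b \<or> T b a" "transp T" "asymp T"
    using interval_graph_precedence[OF assms(1)] by blast
  show ?thesis
    by (rule not_forces_swap[where N = "nonadjacent n E", OF assms(2) T(1)[rule_format] T(2,3)])
qed

text \<open>\<open>L\<close> may differ from \<open>T\<close>, so the last property of
  \<open>T\<close> is transferred through the graph: however \<open>T\<close> orients the two pairs,
  it yields a further nonadjacent pair between them. Either orientation of that pair by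
  \<open>L\<close> gives the claim by transitivity.\<close>

lemma interval_order_lex_orientation:
  assumes G: "interval_graph {..<n} E" and "lex_orientation (nonadjacent n E) L"
  shows "interval_order n L"
proof -
  interpret lex_orientation "nonadjacent n E" L by fact
  show ?thesis
  proof
    fix a b assume "L a b"
    then show "a < n \<and> b < n" using edge by (auto simp: nonadjacent_def)
  next
    fix a b c d assume ab: "L a b" and cd: "L c d"
    obtain T where T: "\<forall>a b. nonadjacent n E a b \<longleftrightarrow> T a b \<or> T b a"
      "\<forall>a b c d. T a b \<longrightarrow> T c d \<longrightarrow> T a d \<or> T c b"
      using interval_graph_precedence[OF G] by blast
    have "T a b \<or> T b a" "T c d \<or> T d c" using ab cd edge T(1) by blast+
    then have "nonadjacent n E a d \<or> nonadjacent n E c b \<or> nonadjacent n E a c \<or> nonadjacent n E b d"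
      using T by (elim disjE) blast+
    then have "L a d \<or> L d a \<or> L c b \<or> L b c \<or> L a c \<or> L c a \<or> L b d \<or> L d b"
      using total by blast
    then show "L a d \<or> L c b" using ab cd by (elim disjE) (blast intro: trans)+
  qed (use asym trans in blast)+
qed

text \<open>Fibres of a stabbing assignment are cliques, since their intervals share the label.
  Conversely, each clique partition is dominated by some stabbing assignment, and \<open>f\<close>
  is best among these.\<close>

lemma output_max_p_mean_clique_partition:
  assumes p: "0 < p" and "lex_orientation (nonadjacent n E) L"
    and "interval_family n l r" and hi_lo: "\<And>u v. u < n \<Longrightarrow> v < n \<Longrightarrow> r u \<le> l v \<longleftrightarrow> L u v"
    and f: "interval_family.stabbing l r f {..<n}"
    and opt: "\<And>g. interval_family.stabbing l r g {..<n} \<Longrightarrow>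
      fibre_value p g {..<n} \<le> fibre_value p f {..<n}"
  shows "max_p_mean_clique_partition p {..<n} E ((\<lambda>v. {u. u < n \<and> f u = f v}) ` {..<n})"
proof -
  interpret lex_orientation "nonadjacent n E" L by fact
  interpret interval_family n l r by fact
  let ?P = "(\<lambda>v. {u. u < n \<and> f u = f v}) ` {..<n}"
  have part: "partition_on {..<n} ?P"
    by (rule partition_onI) (auto simp: disjnt_def)
  have overlap: "l u < r v" if "u < n" "v < n" "u = v \<or> {u, v} \<in> E" for u v
    using that hi_lo[of v u] edge[of v u] less[of u]
    by (auto simp: nonadjacent_def insert_commute not_le[symmetric])
  have "clique C E" if "C \<in> ?P" for C
    unfolding clique_def
  proof (intro ballI impI)
    fix u v assume uv: "u \<in> C" "v \<in> C" "u \<noteq> v"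
    then have lt: "u < n" "v < n" "f u = f v" using that by auto
    have "l u < r v" "l v < r u"
      using f lt by (auto simp: stabbing_def intro: le_less_trans[of _ "f u"])
    then have "\<not> L u v" "\<not> L v u" using hi_lo lt by (simp_all flip: hi_lo)
    then show "{u, v} \<in> E" using total[of u v] lt uv by (auto simp: nonadjacent_def)
  qed
  then have cp: "clique_partition {..<n} E ?P"
    using part by (simp add: clique_partition_def)
  have bs: "block_size ?P v = card {u \<in> {..<n}. f u = f v}" if "v < n" for v
  proof -
    have "(THE C. C \<in> ?P \<and> v \<in> C) = {u. u < n \<and> f u = f v}"
      using that by (intro the_equality) auto
    then show ?thesis by (simp add: block_size_def)
  qed
  have "p_mean p {..<n} Q \<le> p_mean p {..<n} ?P" if Q: "clique_partition {..<n} E Q" for Q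
  proof -
    have Q': "partition_on {..<n} Q" "\<And>C. C \<in> Q \<Longrightarrow> clique C E"
      using Q by (auto simp: clique_partition_def)
    define blk where "blk v = (THE C. C \<in> Q \<and> v \<in> C)" for v
    have blk: "blk v \<in> Q \<and> v \<in> blk v" if "v < n" for v
    proof -
      have "\<exists>!C. C \<in> Q \<and> v \<in> C"
        using partition_onD1[OF Q'(1)] partition_onD2[OF Q'(1)] that
        by (auto simp: disjoint_def)
      then show ?thesis unfolding blk_def by (rule theI')
    qed
    have blk_eq: "blk u = blk v" if "u \<in> blk v" "v < n" for u v
      using blk[OF that(2)] blk[of u] that partition_onD1[OF Q'(1)] partition_onD2[OF Q'(1)]
      by (auto simp: disjoint_def)
    have sub: "blk v \<subseteq> {..<n}" if "v < n" for v
      using blk[OF that] partition_onD1[OF Q'(1)] by auto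
    \<comment> \<open>Helly property of the line: the largest left end point of a clique lies in all
      of its intervals.\<close>
    define g where "g v = Max (l ` blk v)" for v
    have "stabbing g {..<n}"
      unfolding stabbing_def g_def
    proof (intro ballI conjI)
      fix v assume v: "v \<in> {..<n}"
      have fin: "finite (blk v)" using sub[of v] v finite_subset by auto
      show "l v \<le> Max (l ` blk v)" using fin blk v by auto
      have "l u < r v" if "u \<in> blk v" for u
        using that overlap[of u v] sub[of v] v blk[of v] Q'(2)[of "blk v"] by (auto simp: clique_def)
      then show "Max (l ` blk v) < r v" using fin blk[of v] v by (subst Max_less_iff) auto
    qed
    then have "fibre_value p g {..<n} \<le> fibre_value p f {..<n}" by (rule opt)
    \<comment> \<open>Several blocks may receive the same point and merge, which can only enlarge
      the fibres; hence an inequality.\<close>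
    moreover have "(\<Sum>v\<in>{..<n}. real (block_size Q v) powr p) \<le> fibre_value p g {..<n}"
      unfolding fibre_value_def
    proof (intro sum_mono powr_mono2)
      fix v assume "v \<in> {..<n}"
      then have v: "v < n" by simp
      have "blk v \<subseteq> {u \<in> {..<n}. g u = g v}"
        using sub[OF v] blk_eq[OF _ v] by (auto simp: g_def)
      then show "real (block_size Q v) \<le> real (card {u \<in> {..<n}. g u = g v})"
        by (simp add: block_size_def flip: blk_def) (rule card_mono, auto)
    qed (use p in auto)
    moreover have "(\<Sum>v\<in>{..<n}. real (block_size ?P v) powr p) = fibre_value p f {..<n}"
      unfolding fibre_value_def by (intro sum.cong) (auto simp: bs)
    ultimately show ?thesis
      unfolding p_mean_def using p
      by (intro powr_mono2 mult_left_mono mult_nonneg_nonneg sum_nonneg) auto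
  qed
  then show ?thesis using cp by (simp add: max_p_mean_clique_partition_def)
qed

section \<open>Weakest preconditions with a clock\<close>

text \<open>\<open>k\<close> is the time elapsed before \<open>c\<close>, so time bounds become
  conjuncts of postconditions and invariants. Existence of a finished run makes this total
  correctness.\<close>

definition wp :: "com \<Rightarrow> (store \<Rightarrow> nat \<Rightarrow> bool) \<Rightarrow> store \<Rightarrow> nat \<Rightarrow> bool" where
  "wp c Q s k \<longleftrightarrow> (\<exists>t s'. exec c s t s' \<and> Q s' (k + t))"

lemma wp_Skip: "wp Skip Q s k \<longleftrightarrow> Q s (Suc k)"
  by (auto simp: wp_def elim!: exec_SkipE intro!: exec.Skip exI[of _ 1])

lemma wp_NSet: "wp (NSet x i e) Q s k \<longleftrightarrow> Q (nupd x (nval s i) (nval s e) s) (Suc k)"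
  by (auto simp: wp_def elim!: exec_NSetE intro!: exec.NSet exI[of _ 1])

lemma wp_RSet: "wp (RSet x i e) Q s k \<longleftrightarrow> Q (rupd x (nval s i) (rval s e) s) (Suc k)"
  by (auto simp: wp_def elim!: exec_RSetE intro!: exec.RSet exI[of _ 1])

lemma wp_Seq: "wp (Seq c d) Q s k \<longleftrightarrow> wp c (wp d Q) s k"
  by (auto simp: wp_def add.assoc elim!: exec_SeqE) (metis add.assoc exec.Seq)+

lemma wp_Cond: "wp (Cond b c d) Q s k \<longleftrightarrow> (if bval s b then wp c Q s (Suc k) else wp d Q s (Suc k))"
  by (auto simp: wp_def elim!: exec_CondE) (metis add_Suc_right plus_1_eq_Suc exec.CondTrue exec.CondFalse)+

lemmas wp_simps = wp_Skip wp_NSet wp_RSet wp_Seq wp_Cond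

lemma wp_mono: "wp c Q s k \<Longrightarrow> (\<And>s k. Q s k \<Longrightarrow> R s k) \<Longrightarrow> wp c R s k"
  by (auto simp: wp_def)

text \<open>The measure \<open>m\<close> only ensures termination; a bound on the running time has
  to be part of \<open>I\<close>.\<close>

lemma wp_Loop:
  fixes m :: "store \<Rightarrow> nat"
  assumes "I s k"
    and step: "\<And>s k. I s k \<Longrightarrow> bval s b \<Longrightarrow> wp c (\<lambda>s' k'. I s' k' \<and> m s' < m s) s (Suc k)"
    and exit: "\<And>s k. I s k \<Longrightarrow> \<not> bval s b \<Longrightarrow> Q s (Suc k)"
  shows "wp (Loop b c) Q s k"
  using assms(1)
proof (induction "m s" arbitrary: s k rule: less_induct)
  case less
  show ?case
  proof (cases "bval s b")
    case True
    obtain t s' where c: "exec c s t s'" "I s' (Suc k + t)" "m s' < m s"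
      using step[OF less.prems True] by (auto simp: wp_def)
    then obtain u s'' where l: "exec (Loop b c) s' u s''" "Q s'' (Suc k + t + u)"
      using less.hyps[OF c(3,2)] by (auto simp: wp_def)
    have "exec (Loop b c) s (1 + t + u) s''" using True c(1) l(1) by (rule exec.LoopTrue)
    moreover have "Q s'' (k + (1 + t + u))" using l(2) by (simp add: add.assoc)
    ultimately show ?thesis unfolding wp_def by blast
  next
    case False
    have "exec (Loop b c) s 1 s" using False by (rule exec.LoopFalse)
    moreover have "Q s (k + 1)" using exit[OF less.prems False] by simp
    ultimately show ?thesis unfolding wp_def by blast
  qed
qed

abbreviation var :: "nat \<Rightarrow> nexp" where "var x \<equiv> NGet x (NConst 0)"
abbreviation set_var :: "nat \<Rightarrow> nexp \<Rightarrow> com" where "set_var x \<equiv> NSet x (NConst 0)"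

definition For :: "nat \<Rightarrow> nexp \<Rightarrow> com \<Rightarrow> com" where
  "For x e c = Seq (set_var x (NConst 0))
     (Loop (NLess (var x) e) (Seq c (set_var x (NAdd (var x) (NConst 1)))))"

lemma nmem_nupd [simp]: "nmem (nupd x i v s) y j = (if y = x \<and> j = i then v else nmem s y j)"
  by (simp add: nupd_def)
lemma rmem_nupd [simp]: "rmem (nupd x i v s) = rmem s"
  by (simp add: nupd_def)
lemma nmem_rupd [simp]: "nmem (rupd x i v s) = nmem s"
  by (simp add: rupd_def)
lemma rmem_rupd [simp]: "rmem (rupd x i v s) y j = (if y = x \<and> j = i then v else rmem s y j)"
  by (simp add: rupd_def)

text \<open>The limit \<open>e\<close> is evaluated anew in each round, hence \<open>bound\<close>.
  A round costs two steps beyond its body, for guard and increment; initialisation and last guard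
  cost two more.\<close>

lemma wp_For:
  assumes init: "I 0 (nupd x 0 0 s) (Suc k)"
    and step: "\<And>i s k. i < m \<Longrightarrow> nmem s x 0 = i \<Longrightarrow> I i s k \<Longrightarrow>
      wp c (\<lambda>s' k'. nmem s' x 0 = i \<and> I (Suc i) (nupd x 0 (Suc i) s') (Suc k')) s (Suc k)"
    and bound: "\<And>i s k. I i s k \<Longrightarrow> nval s e = m"
    and exit: "\<And>s k. I m s k \<Longrightarrow> nmem s x 0 = m \<Longrightarrow> Q s (Suc k)"
  shows "wp (For x e c) Q s k"
proof -
  let ?J = "\<lambda>s k. nmem s x 0 \<le> m \<and> I (nmem s x 0) s k"
  have "wp (Loop (NLess (var x) e) (Seq c (set_var x (NAdd (var x) (NConst 1))))) Q
    (nupd x 0 0 s) (Suc k)"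
  proof (rule wp_Loop[where I = ?J and m = "\<lambda>s. m - nmem s x 0"])
    show "?J (nupd x 0 0 s) (Suc k)" using init by simp
  next
    fix s k assume J: "?J s k" and b: "bval s (NLess (var x) e)"
    have "nval s e = m" using J bound by blast
    then have "nmem s x 0 < m" using b by simp
    then show "wp (Seq c (set_var x (NAdd (var x) (NConst 1))))
        (\<lambda>s' k'. ?J s' k' \<and> m - nmem s' x 0 < m - nmem s x 0) s (Suc k)"
      unfolding wp_Seq using J by (intro wp_mono[OF step[OF _ refl]]) (auto simp: wp_NSet)
  next
    fix s k assume J: "?J s k" and b: "\<not> bval s (NLess (var x) e)"
    have "nval s e = m" using J bound by blast
    then have "nmem s x 0 = m" using J b by simp
    then show "Q s (Suc k)" using J exit by simp
  qed
  then show ?thesis by (simp add: For_def wp_simps)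
qed

section \<open>Memory predicates\<close>

definition arr :: "nat \<Rightarrow> nat \<Rightarrow> (nat \<Rightarrow> nat) \<Rightarrow> store \<Rightarrow> bool" where
  "arr x m f s \<longleftrightarrow> (\<forall>i<m. nmem s x i = f i)"

text \<open>The first \<open>i\<close> rows and the first \<open>j\<close> entries of the next row of a matrix with \<open>m\<close> columns,
  stored row by row.\<close>

definition cells :: "nat \<Rightarrow> nat \<Rightarrow> nat \<Rightarrow> nat \<Rightarrow> (nat \<Rightarrow> nat \<Rightarrow> nat \<Rightarrow> bool) \<Rightarrow> store \<Rightarrow> bool" where
  "cells x m i j R s \<longleftrightarrow> (\<forall>a b. b < m \<longrightarrow> a < i \<or> a = i \<and> b < j \<longrightarrow> R a b (nmem s x (a * m + b)))"

definition rcells :: "nat \<Rightarrow> nat \<Rightarrow> nat \<Rightarrow> nat \<Rightarrow> (nat \<Rightarrow> nat \<Rightarrow> real) \<Rightarrow> store \<Rightarrow> bool" where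
  "rcells x m i j f s \<longleftrightarrow> (\<forall>a b. b < m \<longrightarrow> a < i \<or> a = i \<and> b < j \<longrightarrow> rmem s x (a * m + b) = f a b)"

abbreviation mat :: "nat \<Rightarrow> nat \<Rightarrow> nat \<Rightarrow> (nat \<Rightarrow> nat \<Rightarrow> nat) \<Rightarrow> store \<Rightarrow> bool" where
  "mat x m i f \<equiv> cells x m i 0 (\<lambda>a b v. v = f a b)"

lemma matrix_index_inject:
  "b < m \<Longrightarrow> d < m \<Longrightarrow> a * m + b = c * m + d \<longleftrightarrow> a = c \<and> b = d" for m :: nat
  by (metis add.commute div_mult_self1_is_m div_mult_self3 div_less add_0 add_left_cancel bot_nat_0.not_eq_extremum not_less_zero)

lemma arr_nupd_other [simp]: "x \<noteq> y \<Longrightarrow> arr x m f (nupd y i v s) = arr x m f s"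
  by (simp add: arr_def)
lemma arr_rupd [simp]: "arr x m f (rupd y i v s) = arr x m f s"
  by (simp add: arr_def)
lemma cells_nupd_other [simp]: "x \<noteq> y \<Longrightarrow> cells x m i j R (nupd y a v s) = cells x m i j R s"
  by (simp add: cells_def)
lemma cells_rupd [simp]: "cells x m i j R (rupd y a v s) = cells x m i j R s"
  by (simp add: cells_def)
lemma rcells_nupd [simp]: "rcells x m i j f (nupd y a v s) = rcells x m i j f s"
  by (simp add: rcells_def)
lemma rcells_rupd_other [simp]: "x \<noteq> y \<Longrightarrow> rcells x m i j f (rupd y a v s) = rcells x m i j f s"
  by (simp add: rcells_def)

lemma arr_0 [simp]: "arr x 0 f s"
  by (simp add: arr_def)
lemma cells_0 [simp]: "cells x m 0 0 R s"
  by (simp add: cells_def)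
lemma rcells_0 [simp]: "rcells x m 0 0 R s"
  by (simp add: rcells_def)

lemma arr_get: "arr x m f s \<Longrightarrow> i < m \<Longrightarrow> nmem s x i = f i"
  by (simp add: arr_def)
lemma cells_get: "cells x m i 0 R s \<Longrightarrow> a < i \<Longrightarrow> b < m \<Longrightarrow> R a b (nmem s x (a * m + b))"
  by (simp add: cells_def)
lemma mat_get: "mat x m i f s \<Longrightarrow> a < i \<Longrightarrow> b < m \<Longrightarrow> nmem s x (a * m + b) = f a b"
  by (simp add: cells_def)
lemma arr_extend: "arr x m f s \<Longrightarrow> v = f m \<Longrightarrow> arr x (Suc m) f (nupd x m v s)"
  by (simp add: arr_def less_Suc_eq)
lemma cells_extend:
  "cells x m i j R s \<Longrightarrow> j < m \<Longrightarrow> R i j v \<Longrightarrow> cells x m i (Suc j) R (nupd x (i * m + j) v s)"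
  by (auto simp: cells_def less_Suc_eq matrix_index_inject)
lemma rcells_extend:
  "rcells x m i j f s \<Longrightarrow> j < m \<Longrightarrow> v = f i j \<Longrightarrow> rcells x m i (Suc j) f (rupd x (i * m + j) v s)"
  by (auto simp: rcells_def less_Suc_eq matrix_index_inject)

lemma cells_next_row: "cells x m i m R s \<Longrightarrow> cells x m (Suc i) 0 R s"
  by (auto simp: cells_def less_Suc_eq)
lemma rcells_next_row: "rcells x m i m R s \<Longrightarrow> rcells x m (Suc i) 0 R s"
  by (auto simp: rcells_def less_Suc_eq)

lemma mat_update:
  "mat x m i f s \<Longrightarrow> b < m \<Longrightarrow> (\<And>u w. g u w = (if u = a \<and> w = b then v else f u w)) \<Longrightarrow>
    mat x m i g (nupd x (a * m + b) v s)"
  by (auto simp: cells_def matrix_index_inject)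

section \<open>The program\<close>

text \<open>Natural arrays 3--20 and real arrays 1--3 are the working memory. Natural array 3 holds the
  row offsets \<open>i * n\<close>, which replace multiplication in index computations; matrices indexed by
  \<open>{0..n}\<close> have \<open>n + 1\<close> columns.\<close>

abbreviation (input) "row_at \<equiv> 3 :: nat"
abbreviation (input) "vI \<equiv> 4 :: nat"
abbreviation (input) "vJ \<equiv> 5 :: nat"
abbreviation (input) "vK \<equiv> 6 :: nat"
abbreviation (input) "q_head \<equiv> 7 :: nat"
abbreviation (input) "q_tail \<equiv> 8 :: nat"
abbreviation (input) "q_src \<equiv> 9 :: nat"
abbreviation (input) "q_tgt \<equiv> 10 :: nat"
abbreviation (input) "vA \<equiv> 11 :: nat"
abbreviation (input) "vB \<equiv> 12 :: nat"
abbreviation (input) "arc_at \<equiv> 13 :: nat"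
abbreviation (input) "lo_at \<equiv> 14 :: nat"
abbreviation (input) "hi_at \<equiv> 15 :: nat"
abbreviation (input) "cnt_at \<equiv> 16 :: nat"
abbreviation (input) "ch_at \<equiv> 17 :: nat"
abbreviation (input) "vV \<equiv> 18 :: nat"
abbreviation (input) "vX \<equiv> 19 :: nat"
abbreviation (input) "vM \<equiv> 20 :: nat"
abbreviation (input) "opt_at \<equiv> 1 :: nat"
abbreviation (input) "best \<equiv> 2 :: nat"
abbreviation (input) "cand \<equiv> 3 :: nat"

abbreviation ind :: "nexp \<Rightarrow> nexp \<Rightarrow> nexp" where
  "ind a b \<equiv> NAdd (NGet row_at a) b"
text \<open>Adding \<open>a\<close> to its offset \<open>a * n\<close> gives
  \<open>a * (n + 1)\<close>, so one offset table serves both kinds of matrices.\<close>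

abbreviation ind' :: "nexp \<Rightarrow> nexp \<Rightarrow> nexp" where
  "ind' a b \<equiv> NAdd (NAdd a (NGet row_at a)) b"
abbreviation size_exp :: nexp where "size_exp \<equiv> var 0"
abbreviation suc_exp :: "nexp \<Rightarrow> nexp" where "suc_exp e \<equiv> NAdd e (NConst 1)"

definition rows_prog :: com where
  "rows_prog = Seq (set_var vX (NConst 0))
     (For vI (suc_exp size_exp)
       (Seq (NSet row_at (var vI) (var vX)) (set_var vX (NAdd (var vX) size_exp))))"

definition lo_prog :: com where
  "lo_prog = For vI size_exp (Seq (set_var vX (NConst 0))
     (Seq (For vJ size_exp (set_var vX (NAdd (var vX) (NGet arc_at (ind (var vJ) (var vI))))))
       (NSet lo_at (var vI) (var vX))))"

definition hi_prog :: com where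
  "hi_prog = For vI size_exp (Seq (set_var vX size_exp)
     (Seq (For vJ size_exp
         (Cond (Conj (NLess (NConst 0) (NGet arc_at (ind (var vI) (var vJ))))
                     (NLess (NGet lo_at (var vJ)) (var vX)))
           (set_var vX (NGet lo_at (var vJ))) Skip))
       (NSet hi_at (var vI) (var vX))))"

definition cnt_prog :: com where
  "cnt_prog = For vI (suc_exp size_exp) (For vJ (suc_exp size_exp) (Seq (set_var vX (NConst 0))
     (Seq (For vV size_exp
         (Cond (Conj (Neg (NLess (NGet lo_at (var vV)) (var vI)))
                     (Neg (NLess (var vJ) (NGet hi_at (var vV)))))
           (set_var vX (suc_exp (var vX))) Skip))
       (NSet cnt_at (ind' (var vI) (var vJ)) (var vX)))))"

text \<open>Row \<open>m\<close> of the tables at \<open>opt_at\<close> and \<open>ch_at\<close> belongs to the left end \<open>n - m\<close>, so that the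
  rows are filled in increasing order.\<close>

definition gain_exp :: rexp where
  "gain_exp = RAdd (RAdd
     (RPow (RNat (NSub (NSub (NGet cnt_at (ind' (var vI) (var vJ))) (NGet cnt_at (ind' (var vI) (var vK))))
              (NGet cnt_at (ind' (suc_exp (var vK)) (var vJ)))))
           (RAdd (RGet 0 (NConst 0)) (RNat (NConst 1))))
     (RGet opt_at (ind' (var vM) (var vK))))
     (RGet opt_at (ind' (NSub size_exp (suc_exp (var vK))) (var vJ)))"

text \<open>The first candidate, at \<open>vK = vI\<close>, is accepted whatever its gain: if all
  gains are 0, a strict comparison with the initial 0 could leave the recorded choice outside the
  window.\<close>

definition opt_prog :: com where
  "opt_prog = For vM (suc_exp size_exp) (Seq (set_var vI (NSub size_exp (var vM)))
     (For vJ (suc_exp size_exp) (Seq (RSet best (NConst 0) (RNat (NConst 0))) (Seq (set_var vX (NConst 0))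
       (Seq (For vK (var vJ)
           (Cond (NLess (var vK) (var vI)) Skip
             (Seq (RSet cand (NConst 0) gain_exp)
               (Cond (Conj (NLess (var vI) (var vK))
                       (Neg (RLess (RGet best (NConst 0)) (RGet cand (NConst 0)))))
                 Skip
                 (Seq (RSet best (NConst 0) (RGet cand (NConst 0))) (set_var vX (var vK)))))))
         (Seq (RSet opt_at (ind' (var vM) (var vJ)) (RGet best (NConst 0)))
           (NSet ch_at (ind' (var vM) (var vJ)) (var vX))))))))"

text \<open>\<open>vA\<close> holds the table row \<open>n - i\<close> instead of the left end
  \<open>i\<close>. While the point \<open>vX\<close> misses the interval of \<open>vV\<close>,
  comparing it with the right end alone tells on which side it lies.\<close>

definition label_prog :: com where
  "label_prog = For vV size_exp (Seq (set_var vA size_exp) (Seq (set_var vB size_exp)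
     (Seq (set_var vX (NGet ch_at (ind' (var vA) (var vB))))
       (Seq (Loop (Neg (Conj (Neg (NLess (var vX) (NGet lo_at (var vV))))
                        (NLess (var vX) (NGet hi_at (var vV)))))
           (Seq (Cond (NLess (var vX) (NGet hi_at (var vV)))
               (set_var vA (NSub size_exp (suc_exp (var vX))))
               (set_var vB (var vX)))
             (set_var vX (NGet ch_at (ind' (var vA) (var vB))))))
         (NSet 2 (var vV) (var vX))))))"

lemma card_less_Suc_Collect:
  "card {u. u < Suc j \<and> P u} = card {u. u < j \<and> P u} + of_bool (P j)"
proof -
  have "{u. u < Suc j \<and> P u} = (if P j then insert j {u. u < j \<and> P u} else {u. u < j \<and> P u})"
    by (auto simp: less_Suc_eq)
  then show ?thesis by simp
qed

lemma Min_less_Suc_Collect: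
  fixes f :: "nat \<Rightarrow> nat"
  shows "Min (insert n {f w | w. w < Suc j \<and> P w}) =
    (if P j \<and> f j < Min (insert n {f w | w. w < j \<and> P w}) then f j
     else Min (insert n {f w | w. w < j \<and> P w}))"
proof -
  have "insert n {f w | w. w < Suc j \<and> P w} =
    (if P j then insert (f j) (insert n {f w | w. w < j \<and> P w}) else insert n {f w | w. w < j \<and> P w})"
    by (auto simp: less_Suc_eq)
  moreover have "Min (insert (f j) A) = (if f j < Min A then f j else Min A)"
    if "finite A" "A \<noteq> {}" for A
    using Min_insert[OF that, of "f j"] by (metis min_def order_le_less)
  ultimately show ?thesis by (simp del: Min_gr_iff Min_less_iff Min_insert)
qed

section \<open>Table-filling phases of the program\<close>

locale prog_store =
  fixes n :: nat and E :: "nat set set" and p :: real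
begin

definition inp :: "store \<Rightarrow> bool" where
  "inp s \<longleftrightarrow> nmem s 0 0 = n \<and> mat 1 n n (\<lambda>a b. of_bool ({a, b} \<in> E)) s \<and> rmem s 0 0 = p"

definition base :: "store \<Rightarrow> bool" where
  "base s \<longleftrightarrow> inp s \<and> arr row_at (Suc n) (\<lambda>i. i * n) s"

lemma inp_nupd [simp]: "x \<noteq> 0 \<Longrightarrow> x \<noteq> 1 \<Longrightarrow> inp (nupd x i v s) = inp s"
  by (simp add: inp_def)
lemma inp_rupd [simp]: "x \<noteq> 0 \<Longrightarrow> inp (rupd x i v s) = inp s"
  by (simp add: inp_def)
lemma base_nupd [simp]: "x \<noteq> 0 \<Longrightarrow> x \<noteq> 1 \<Longrightarrow> x \<noteq> 3 \<Longrightarrow> base (nupd x i v s) = base s"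
  by (simp add: base_def)
lemma base_rupd [simp]: "x \<noteq> 0 \<Longrightarrow> base (rupd x i v s) = base s"
  by (simp add: base_def)
lemma base_adj: "base s \<Longrightarrow> a < n \<Longrightarrow> b < n \<Longrightarrow> nmem s 1 (a * n + b) = of_bool ({a, b} \<in> E)"
  by (simp add: base_def inp_def cells_def)
lemma base_row: "base s \<Longrightarrow> i \<le> n \<Longrightarrow> nmem s 3 i = i * n"
  by (simp add: base_def arr_def)
lemma base_p: "base s \<Longrightarrow> rmem s 0 0 = p"
  by (simp add: base_def inp_def)
lemma base_n: "base s \<Longrightarrow> nmem s 0 0 = n"
  by (simp add: base_def inp_def)
lemma inp_n: "inp s \<Longrightarrow> nmem s 0 0 = n"
  by (simp add: inp_def)
lemma baseI: "inp s \<Longrightarrow> arr row_at (Suc n) (\<lambda>i. i * n) s \<Longrightarrow> base s"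
  by (simp add: base_def)

declare inp_n [simp] base_n [simp] base_p [simp] base_row [simp]

lemma wp_rows:
  assumes "inp s" "mat arc_at n n f s"
    and Q: "\<And>s k'. base s \<Longrightarrow> mat arc_at n n f s \<Longrightarrow> k' \<le> k + 4 * n + 7 \<Longrightarrow> Q s k'"
  shows "wp rows_prog Q s k"
  unfolding rows_prog_def wp_Seq wp_NSet
  by (rule wp_For[where m = "Suc n" and I = "\<lambda>i s k'. inp s \<and> mat arc_at n n f s \<and>
    arr row_at i (\<lambda>i. i * n) s \<and> nmem s vX 0 = i * n \<and> k' \<le> k + 2 + 4 * i"])
    (use assms in \<open>auto simp: wp_simps intro!: Q baseI arr_extend\<close>)

lemma wp_lo:
  assumes "base s" "mat arc_at n n (\<lambda>a b. of_bool (L a b)) s"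
    and Q: "\<And>s k'. base s \<Longrightarrow> mat arc_at n n (\<lambda>a b. of_bool (L a b)) s \<Longrightarrow>
      arr lo_at n (\<lambda>v. card {u. u < n \<and> L u v}) s \<Longrightarrow> k' \<le> k + n * (3 * n + 7) + 2 \<Longrightarrow> Q s k'"
  shows "wp lo_prog Q s k"
  unfolding lo_prog_def
proof (rule wp_For[where m = n and I = "\<lambda>i s k'. base s \<and>
    mat arc_at n n (\<lambda>a b. of_bool (L a b)) s \<and>
    arr lo_at i (\<lambda>v. card {u. u < n \<and> L u v}) s \<and> k' \<le> k + 1 + i * (3 * n + 7)"], goal_cases)
  case (2 i s' k')
  show ?case
    unfolding wp_Seq wp_NSet
    by (rule wp_For[where m = n and I = "\<lambda>j s k''. base s \<and>
      mat arc_at n n (\<lambda>a b. of_bool (L a b)) s \<and> nmem s vI 0 = i \<and>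
      arr lo_at i (\<lambda>v. card {u. u < n \<and> L u v}) s \<and>
      nmem s vX 0 = card {u. u < j \<and> L u i} \<and> k'' \<le> k' + 3 + 3 * j"])
     (use 2 in \<open>auto simp: wp_simps mat_get card_less_Suc_Collect intro!: arr_extend\<close>)
qed (use assms in auto)

lemma wp_hi:
  assumes "base s" "mat arc_at n n (\<lambda>a b. of_bool (L a b)) s" "arr lo_at n f s"
    and Q: "\<And>s k'. base s \<Longrightarrow> arr lo_at n f s \<Longrightarrow>
      arr hi_at n (\<lambda>v. Min (insert n {f w | w. w < n \<and> L v w})) s \<Longrightarrow>
      k' \<le> k + n * (4 * n + 7) + 2 \<Longrightarrow> Q s k'"
  shows "wp hi_prog Q s k"
  unfolding hi_prog_def
proof (rule wp_For[where m = n and I = "\<lambda>i s k'. base s \<and>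
    mat arc_at n n (\<lambda>a b. of_bool (L a b)) s \<and> arr lo_at n f s \<and>
    arr hi_at i (\<lambda>v. Min (insert n {f w | w. w < n \<and> L v w})) s \<and>
    k' \<le> k + 1 + i * (4 * n + 7)"], goal_cases)
  case (2 i s' k')
  show ?case
    unfolding wp_Seq wp_NSet
    by (rule wp_For[where m = n and I = "\<lambda>j s k''. base s \<and>
      mat arc_at n n (\<lambda>a b. of_bool (L a b)) s \<and> nmem s vI 0 = i \<and> arr lo_at n f s \<and>
      arr hi_at i (\<lambda>v. Min (insert n {f w | w. w < n \<and> L v w})) s \<and>
      nmem s vX 0 = Min (insert n {f w | w. w < j \<and> L i w}) \<and> k'' \<le> k' + 3 + 4 * j"])
     (use 2 in \<open>auto simp: wp_simps mat_get arr_get Min_less_Suc_Collect simp del: Min_insert Min_gr_iff Min_less_iff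
       intro!: arr_extend\<close>)
qed (use assms in auto)

lemma wp_cnt:
  assumes "base s" "arr lo_at n l s" "arr hi_at n r s"
    and Q: "\<And>s k'. base s \<Longrightarrow> arr lo_at n l s \<Longrightarrow> arr hi_at n r s \<Longrightarrow>
      mat cnt_at (Suc n) (Suc n) (\<lambda>i j. card {v. v < n \<and> i \<le> l v \<and> r v \<le> j}) s \<Longrightarrow>
      k' \<le> k + Suc n * (Suc n * (4 * n + 7) + 4) + 2 \<Longrightarrow> Q s k'"
  shows "wp cnt_prog Q s k"
  unfolding cnt_prog_def
proof (rule wp_For[where m = "Suc n" and I = "\<lambda>i s k'. base s \<and> arr lo_at n l s \<and> arr hi_at n r s \<and>
    mat cnt_at (Suc n) i (\<lambda>i j. card {v. v < n \<and> i \<le> l v \<and> r v \<le> j}) s \<and>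
    k' \<le> k + 1 + i * (Suc n * (4 * n + 7) + 4)"], goal_cases)
  case (2 i s1 k1)
  show ?case
  proof (rule wp_For[where m = "Suc n" and I = "\<lambda>j s k'. base s \<and> arr lo_at n l s \<and>
      arr hi_at n r s \<and> nmem s vI 0 = i \<and>
      cells cnt_at (Suc n) i j (\<lambda>i j x. x = card {v. v < n \<and> i \<le> l v \<and> r v \<le> j}) s \<and>
      k' \<le> k1 + 2 + j * (4 * n + 7)"], goal_cases)
    case (2 j s2 k2)
    show ?case
      unfolding wp_Seq wp_NSet
    proof (rule wp_For[where m = n and I = "\<lambda>u s k'. base s \<and> arr lo_at n l s \<and>
        arr hi_at n r s \<and> nmem s vI 0 = i \<and> nmem s vJ 0 = j \<and>
        cells cnt_at (Suc n) i j (\<lambda>i j x. x = card {v. v < n \<and> i \<le> l v \<and> r v \<le> j}) s \<and>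
        nmem s vX 0 = card {v. v < u \<and> i \<le> l v \<and> r v \<le> j} \<and> k' \<le> k2 + 3 + 4 * u"], goal_cases)
      case (4 s3 k3)
      then show ?case using \<open>i < Suc n\<close> 2
        using cells_extend[of cnt_at "Suc n" i j _ s3 "nmem s3 vX 0"] by simp
    qed (use 2 in \<open>auto simp: wp_simps arr_get card_less_Suc_Collect\<close>)
  next
    case (4 s2 k2)
    then show ?case using 2 by (auto intro: cells_next_row)
  qed (use 2 in auto)
qed (use assms in auto)

end

locale prog_intervals = prog_store n E p + interval_family n l r
  for n :: nat and E :: "nat set set" and p :: real and l r :: "nat \<Rightarrow> nat"
begin

text \<open>Both subwindows are already tabulated: the left one in the current row at a column
  before \<open>j\<close>, the right one in the earlier row \<open>n - Suc k\<close>.\<close>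

lemma rval_gain_exp:
  assumes "base s" and cnt: "mat cnt_at (Suc n) (Suc n) (\<lambda>i j. card (bag i j)) s"
    and opt: "rcells opt_at (Suc n) (n - i) j (\<lambda>m. opt p (n - m)) s"
    and v: "nmem s vI 0 = i" "nmem s vJ 0 = j" "nmem s vK 0 = k" "nmem s vM 0 = n - i"
    and ik: "i \<le> k" "k < j" "j \<le> n"
  shows "rval s gain_exp = gain p i j k"
proof -
  have "rmem s opt_at ((n - i) * Suc n + k) = opt p i k"
    using opt ik by (auto simp: rcells_def)
  moreover have "rmem s opt_at ((n - Suc k) * Suc n + j) = opt p (Suc k) j"
    using opt[unfolded rcells_def, rule_format, of j "n - Suc k"] ik by auto
  moreover have "nmem s cnt_at (i * Suc n + j) = card (bag i j)"
    "nmem s cnt_at (i * Suc n + k) = card (bag i k)"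
    "nmem s cnt_at (Suc k * Suc n + j) = card (bag (Suc k) j)"
    using mat_get[OF cnt, of i j] mat_get[OF cnt, of i k] mat_get[OF cnt, of "Suc k" j] ik by auto
  ultimately show ?thesis
    using assms(1) v ik by (simp add: gain_exp_def gain_def card_stabbed)
qed

text \<open>Maximisers are not unique, so table entries are specified by a property instead of a
  value.\<close>

definition choice_ok :: "nat \<Rightarrow> nat \<Rightarrow> nat \<Rightarrow> bool" where
  "choice_ok i j x \<longleftrightarrow> (i < j \<longrightarrow> i \<le> x \<and> x < j \<and> gain p i j x = opt p i j)"

text \<open>As long as \<open>k \<le> i\<close> no candidate has been tried, and 0 is then the
  correct optimum if the window is empty, that is \<open>j \<le> i\<close>.\<close>

definition search_inv :: "nat \<Rightarrow> nat \<Rightarrow> nat \<Rightarrow> store \<Rightarrow> bool" where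
  "search_inv i j k s \<longleftrightarrow> (k \<le> i \<longrightarrow> rmem s best 0 = 0) \<and> (i < k \<longrightarrow> i \<le> nmem s vX 0 \<and> nmem s vX 0 < k \<and>
     rmem s best 0 = gain p i j (nmem s vX 0) \<and> (\<forall>y. i \<le> y \<longrightarrow> y < k \<longrightarrow> gain p i j y \<le> rmem s best 0))"

lemma search_inv_done:
  assumes "search_inv i j j s"
  shows "rmem s best 0 = opt p i j" "choice_ok i j (nmem s vX 0)"
proof -
  have "rmem s best 0 = opt p i j \<and> choice_ok i j (nmem s vX 0)"
  proof (cases "i < j")
    case True
    then have "Max (gain p i j ` {i..<j}) = rmem s best 0"
      using assms by (intro Max_eqI) (auto simp: search_inv_def)
    then show ?thesis using assms True by (simp add: search_inv_def choice_ok_def opt_eq_Max)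
  next
    case False
    then show ?thesis using assms by (simp add: search_inv_def choice_ok_def opt_empty)
  qed
  then show "rmem s best 0 = opt p i j" "choice_ok i j (nmem s vX 0)" by auto
qed

lemma wp_opt:
  assumes "base s" "arr lo_at n l s" "arr hi_at n r s"
    and "mat cnt_at (Suc n) (Suc n) (\<lambda>i j. card (bag i j)) s"
    and Q: "\<And>s k'. base s \<Longrightarrow> arr lo_at n l s \<Longrightarrow> arr hi_at n r s \<Longrightarrow>
      cells ch_at (Suc n) (Suc n) 0 (\<lambda>m. choice_ok (n - m)) s \<Longrightarrow>
      k' \<le> k + Suc n * (Suc n * (7 * n + 9) + 5) + 2 \<Longrightarrow> Q s k'"
  shows "wp opt_prog Q s k"
  unfolding opt_prog_def
proof (rule wp_For[where m = "Suc n" and I = "\<lambda>m s k'. base s \<and> arr lo_at n l s \<and>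
    arr hi_at n r s \<and> mat cnt_at (Suc n) (Suc n) (\<lambda>i j. card (bag i j)) s \<and>
    rcells opt_at (Suc n) m 0 (\<lambda>m. opt p (n - m)) s \<and>
    cells ch_at (Suc n) m 0 (\<lambda>m. choice_ok (n - m)) s \<and>
    k' \<le> k + 1 + m * (Suc n * (7 * n + 9) + 5)"], goal_cases)
  case (2 m s1 k1)
  then have m: "m \<le> n" by simp
  show ?case
    unfolding wp_Seq wp_NSet
  proof (rule wp_For[where m = "Suc n" and I = "\<lambda>j s k'. base s \<and> arr lo_at n l s \<and>
      arr hi_at n r s \<and> mat cnt_at (Suc n) (Suc n) (\<lambda>i j. card (bag i j)) s \<and>
      nmem s vM 0 = m \<and> nmem s vI 0 = n - m \<and>
      rcells opt_at (Suc n) m j (\<lambda>m. opt p (n - m)) s \<and>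
      cells ch_at (Suc n) m j (\<lambda>m. choice_ok (n - m)) s \<and>
      k' \<le> k1 + 3 + j * (7 * n + 9)"], goal_cases)
    case (2 j s2 k2)
    then have j: "j \<le> n" by simp
    show ?case
      unfolding wp_Seq wp_NSet wp_RSet
    proof (rule wp_For[where m = j and I = "\<lambda>k s k'. base s \<and> arr lo_at n l s \<and>
        arr hi_at n r s \<and> mat cnt_at (Suc n) (Suc n) (\<lambda>i j. card (bag i j)) s \<and>
        nmem s vM 0 = m \<and> nmem s vI 0 = n - m \<and> nmem s vJ 0 = j \<and>
        rcells opt_at (Suc n) m j (\<lambda>m. opt p (n - m)) s \<and>
        cells ch_at (Suc n) m j (\<lambda>m. choice_ok (n - m)) s \<and>
        search_inv (n - m) j k s \<and> k' \<le> k2 + 4 + 7 * k"], goal_cases)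
      case (2 k s3 k3)
      show ?case
      proof (cases "k < n - m")
        case True
        then show ?thesis using 2 by (auto simp: wp_simps search_inv_def)
      next
        case False
        have "rval s3 gain_exp = gain p (n - m) j k"
          using 2 False m j by (intro rval_gain_exp) auto
        then show ?thesis
          using 2 False by (auto simp: wp_simps search_inv_def less_Suc_eq not_less)
      qed
    next
      case (4 s3 k3)
      have "rcells opt_at (Suc n) m (Suc j) (\<lambda>m. opt p (n - m)) (rupd opt_at (m * Suc n + j) (rmem s3 best 0) s3)"
        using 4 j search_inv_done by (intro rcells_extend) auto
      moreover have "cells ch_at (Suc n) m (Suc j) (\<lambda>m. choice_ok (n - m))
          (nupd ch_at (m * Suc n + j) (nmem s3 vX 0) (rupd opt_at (m * Suc n + j) (rmem s3 best 0) s3))"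
        using 4 j search_inv_done by (intro cells_extend) auto
      ultimately show ?case using 4 m 2 by simp
    qed (use 2 in \<open>auto simp: search_inv_def\<close>)
  next
    case (4 s2 k2)
    then show ?case using 2 by (auto intro: cells_next_row rcells_next_row)
  qed (use 2 in auto)
qed (use assms in auto)

end

locale prog_labels = prog_store n E p + optimal_choice n l r p ch
  for n :: nat and E :: "nat set set" and p :: real and l r :: "nat \<Rightarrow> nat"
    and ch :: "nat \<Rightarrow> nat \<Rightarrow> nat"
begin

definition tables :: "store \<Rightarrow> bool" where
  "tables s \<longleftrightarrow> base s \<and> arr lo_at n l s \<and> arr hi_at n r s \<and>
     mat ch_at (Suc n) (Suc n) (\<lambda>m. ch (n - m)) s"

lemma tables_nupd [simp]:
  "x \<noteq> 0 \<Longrightarrow> x \<noteq> 1 \<Longrightarrow> x \<noteq> 3 \<Longrightarrow> x \<noteq> lo_at \<Longrightarrow> x \<noteq> hi_at \<Longrightarrow> x \<noteq> ch_at \<Longrightarrow>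
    tables (nupd x i v s) = tables s"
  by (simp add: tables_def)

lemma tables_base: "tables s \<Longrightarrow> base s"
  and tables_lo: "tables s \<Longrightarrow> v < n \<Longrightarrow> nmem s lo_at v = l v"
  and tables_hi: "tables s \<Longrightarrow> v < n \<Longrightarrow> nmem s hi_at v = r v"
  by (simp_all add: tables_def arr_def)

text \<open>The index has the shape to which \<open>ind'\<close> evaluates; it equals
  \<open>(n - i) * Suc n + j\<close>.\<close>

lemma tables_choice:
  assumes "tables s" "i \<le> n" "j \<le> n"
  shows "nmem s ch_at (n - i + (n - i) * n + j) = ch i j"
  using assms mat_get[of ch_at "Suc n" "Suc n" "\<lambda>m. ch (n - m)" s "n - i" j]
  by (simp add: tables_def)

declare tables_base [simp] tables_lo [simp] tables_hi [simp]

lemma wp_label: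
  assumes "tables s"
    and Q: "\<And>s k'. arr 2 n (label 0 n) s \<Longrightarrow> k' \<le> k + n * (4 * n + 8) + 2 \<Longrightarrow> Q s k'"
  shows "wp label_prog Q s k"
  unfolding label_prog_def
proof (rule wp_For[where m = n and I = "\<lambda>v s k'. tables s \<and> arr 2 v (label 0 n) s \<and>
    k' \<le> k + 1 + v * (4 * n + 8)"], goal_cases)
  case (2 v s1 k1)
  have bag: "i < j" if "v \<in> bag i j" for i j
    using that less[of v] by (simp add: bag_def)
  show ?case
    unfolding wp_Seq wp_NSet
  \<comment> \<open>A round costs four steps and shortens the window by at least one, so
    \<open>k' + 4 * (j - i)\<close> never grows.\<close>
  proof (rule wp_Loop[where m = "\<lambda>s. nmem s vB 0 - (n - nmem s vA 0)" and
      I = "\<lambda>s k'. tables s \<and> arr 2 v (label 0 n) s \<and> nmem s vV 0 = v \<and>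
        (\<exists>i j. nmem s vA 0 = n - i \<and> nmem s vB 0 = j \<and> i \<le> n \<and> j \<le> n \<and> v \<in> bag i j \<and>
          label i j v = label 0 n v \<and> nmem s vX 0 = ch i j \<and>
          k' + 4 * (j - i) \<le> k1 + 4 + 4 * n)"], goal_cases)
    case 1
    show ?case
      using 2 tables_choice[of s1 0 n] by (auto simp: bag_all intro!: exI[of _ 0])
  next
    case (2 s k')
    then obtain i j where ij: "nmem s vA 0 = n - i" "nmem s vB 0 = j" "i \<le> n" "j \<le> n"
      "v \<in> bag i j" "label i j v = label 0 n v" "nmem s vX 0 = ch i j"
      "k' + 4 * (j - i) \<le> k1 + 4 + 4 * n" by blast
    have ch': "i \<le> ch i j" "ch i j < j" using ch bag ij by auto
    show ?case
    proof (cases "ch i j < r v")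
      case True
      then have lt: "ch i j < l v" using 2 ij \<open>v < n\<close> by auto
      then have "v \<in> bag (Suc (ch i j)) j" using ij(5) by (simp add: bag_def)
      moreover have "label (Suc (ch i j)) j v = label i j v"
        using ch' lt True by (subst (2) label.simps) simp
      moreover have "Suc (ch i j) \<le> n" using ch' ij by simp
      ultimately show ?thesis
        using True 2 ij ch' \<open>v < n\<close> tables_choice[of _ "Suc (ch i j)" j]
        by (auto simp: wp_simps intro!: exI[of _ "Suc (ch i j)"])
    next
      case False
      then have "v \<in> bag i (ch i j)" using ij(5) by (simp add: bag_def)
      moreover have "label i (ch i j) v = label i j v"
        using ch' False by (subst (2) label.simps) simp
      ultimately show ?thesis
        using False 2 ij ch' \<open>v < n\<close> tables_choice[of _ i "ch i j"]
        by (auto simp: wp_simps intro!: exI[of _ i])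
    qed
  next
    case (3 s k')
    then obtain i j where ij: "v \<in> bag i j" "j \<le> n" "label i j v = label 0 n v" "nmem s vX 0 = ch i j"
      "k' + 4 * (j - i) \<le> k1 + 4 + 4 * n" by blast
    have "label i j v = ch i j"
      using 3 ij \<open>v < n\<close> by (subst label.simps) auto
    then show ?case
      using 3 ij 2 bag[OF ij(1)] by (auto simp: intro!: arr_extend)
  qed
qed (use assms in auto)

end

section \<open>Propagation of forced arcs through a queue\<close>

definition push :: "nat \<Rightarrow> nat \<Rightarrow> com" where
  "push x y = Seq (NSet arc_at (ind (var x) (var y)) (NConst 1))
     (Seq (NSet q_src (var q_tail) (var x)) (Seq (NSet q_tgt (var q_tail) (var y))
       (set_var q_tail (suc_exp (var q_tail)))))"

definition scan_prog :: com where
  "scan_prog = For vK size_exp (Seq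
     (Cond (Conj (NLess (NConst 0) (NGet 1 (ind (var vA) (var vK))))
       (Conj (NLess (NGet 1 (ind (var vK) (var vB))) (NConst 1))
         (NLess (NGet arc_at (ind (var vK) (var vB))) (NConst 1)))) (push vK vB) Skip)
     (Cond (Conj (NLess (NConst 0) (NGet 1 (ind (var vB) (var vK))))
       (Conj (NLess (NGet 1 (ind (var vA) (var vK))) (NConst 1))
         (NLess (NGet arc_at (ind (var vA) (var vK))) (NConst 1)))) (push vA vK) Skip))"

definition pop_prog :: com where
  "pop_prog = Seq (set_var vA (NGet q_src (var q_head))) (Seq (set_var vB (NGet q_tgt (var q_head)))
     (Seq (set_var q_head (suc_exp (var q_head))) scan_prog))"

definition orient_prog :: com where
  "orient_prog = Seq (set_var q_head (NConst 0)) (Seq (set_var q_tail (NConst 0))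
     (For vI size_exp (For vJ size_exp
       (Cond (Conj (Conj (NLess (var vI) (var vJ)) (NLess (NGet 1 (ind (var vI) (var vJ))) (NConst 1)))
           (Conj (NLess (NGet arc_at (ind (var vI) (var vJ))) (NConst 1))
             (NLess (NGet arc_at (ind (var vJ) (var vI))) (NConst 1))))
         (Seq (push vI vJ) (Loop (NLess (var q_head) (var q_tail)) pop_prog)) Skip))))"

locale prog_graph = prog_store n E p for n :: nat and E :: "nat set set" and p :: real +
  assumes G: "interval_graph {..<n} E"
begin

abbreviation "N \<equiv> nonadjacent n E"
abbreviation "F \<equiv> forces N"

lemma no_loop: "{a} \<notin> E"
  using G by (auto simp: interval_graph_def simple_graph_def nsets_def)

lemmas sym_N = symp_nonadjacent[of n E]

text \<open>The last clause is the condition \<open>lex\<close> of \<open>lex_orientation\<close>,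
  required already of partial orientations.\<close>

definition good :: "(nat \<times> nat) set \<Rightarrow> bool" where
  "good O' \<longleftrightarrow> (\<forall>a b. (a, b) \<in> O' \<longrightarrow> N a b \<and> (b, a) \<notin> O' \<and>
     (b < a \<longrightarrow> (\<exists>x y. F\<^sup>*\<^sup>* (a, b) (x, y) \<and> x < y \<and> (x < b \<or> x = b \<and> y < a))))"

definition closed :: "(nat \<times> nat) set \<Rightarrow> bool" where
  "closed O' \<longleftrightarrow> (\<forall>x y. x \<in> O' \<longrightarrow> F x y \<longrightarrow> y \<in> O')"

definition decided :: "nat \<Rightarrow> nat \<Rightarrow> (nat \<times> nat) set \<Rightarrow> bool" where
  "decided i j O' \<longleftrightarrow> (\<forall>x y. N x y \<longrightarrow> x < y \<longrightarrow> (x < i \<or> x = i \<and> y < j) \<longrightarrow>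
     (x, y) \<in> O' \<or> (y, x) \<in> O')"

text \<open>Bounds from both sides instead of an equation, because the class of \<open>e\<close> may
  be propagated only in part.\<close>

definition spread :: "(nat \<times> nat) set \<Rightarrow> nat \<times> nat \<Rightarrow> (nat \<times> nat) set \<Rightarrow> bool" where
  "spread O0 e O' \<longleftrightarrow> insert e O0 \<subseteq> O' \<and> O' \<subseteq> O0 \<union> {x. F\<^sup>*\<^sup>* e x}"

definition arcs :: "(nat \<times> nat) set \<Rightarrow> bool" where
  "arcs O' \<longleftrightarrow> (\<forall>a b. (a, b) \<in> O' \<longrightarrow> N a b)"

lemma arcs_subset: "arcs O' \<Longrightarrow> O' \<subseteq> {..<n} \<times> {..<n}"
  by (auto simp: arcs_def nonadjacent_def)

lemma arcs_finite: "arcs O' \<Longrightarrow> finite O'"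
  using arcs_subset finite_subset by blast

lemma card_arcs: "arcs O' \<Longrightarrow> card O' \<le> n * n"
  using card_mono[OF _ arcs_subset, of O'] by simp

lemma closed_rtranclp: "closed O' \<Longrightarrow> x \<in> O' \<Longrightarrow> F\<^sup>*\<^sup>* x y \<Longrightarrow> y \<in> O'"
  using forces_rtranclp_closed[of N x y O'] by (auto simp: closed_def)

lemma spread_refl: "spread O0 e (insert e O0)"
  by (auto simp: spread_def)

lemma spread_step: "closed O0 \<Longrightarrow> spread O0 e O' \<Longrightarrow> x \<in> O' \<Longrightarrow> F x y \<Longrightarrow> spread O0 e (insert y O')"
  unfolding spread_def closed_def by (blast intro: rtranclp.rtrancl_into_rtrancl)

text \<open>A conflict of a new arc with an old one would put \<open>(j, i)\<close> into the closed
  set \<open>O0\<close>; one between new arcs would put an arc and its reverse into one class,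
  impossible in an interval graph. For a new downward arc the seed \<open>(i, j)\<close> is the
  smaller upward arc, since all non-edges before it are decided.\<close>

lemma spread_good:
  assumes good: "good O0" and cl: "closed O0" and dec: "decided i j O0"
    and ij: "N i j" "i < j" "(i, j) \<notin> O0" "(j, i) \<notin> O0" and sp: "spread O0 (i, j) O'"
  shows "good O'"
  unfolding good_def
proof (intro allI impI)
  fix a b assume ab: "(a, b) \<in> O'"
  then have cases: "(a, b) \<in> O0 \<or> F\<^sup>*\<^sup>* (i, j) (a, b)" using sp by (auto simp: spread_def)
  have swap: "(y, x) \<notin> O0" if "F\<^sup>*\<^sup>* (i, j) (x, y)" for x y
  proof
    assume "(y, x) \<in> O0"
    moreover have "F\<^sup>*\<^sup>* (y, x) (j, i)"
      using forces_rtranclp_sym[OF forces_rtranclp_swap[OF that sym_N] sym_N] by simp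
    ultimately show False using closed_rtranclp[OF cl] ij by blast
  qed
  have Nab: "N a b" using cases good ij(1) forces_rtranclp_dom[of N "(i, j)" "(a, b)"]
    by (auto simp: good_def)
  have "(b, a) \<notin> O'"
  proof
    assume "(b, a) \<in> O'"
    then have cases': "(b, a) \<in> O0 \<or> F\<^sup>*\<^sup>* (i, j) (b, a)" using sp by (auto simp: spread_def)
    consider "(a, b) \<in> O0" "(b, a) \<in> O0" | "F\<^sup>*\<^sup>* (i, j) (a, b)" "(b, a) \<in> O0"
      | "F\<^sup>*\<^sup>* (i, j) (b, a)" "(a, b) \<in> O0" | "F\<^sup>*\<^sup>* (i, j) (a, b)" "F\<^sup>*\<^sup>* (i, j) (b, a)"
      using cases cases' by blast
    then show False
    proof cases
      case 4
      then have "F\<^sup>*\<^sup>* (a, b) (b, a)"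
        using forces_rtranclp_sym[OF _ sym_N] by (meson rtranclp_trans)
      then show False using not_forces_swap_interval_graph[OF G Nab] by blast
    qed (use good swap in \<open>auto simp: good_def\<close>)
  qed
  moreover have "\<exists>x y. F\<^sup>*\<^sup>* (a, b) (x, y) \<and> x < y \<and> (x < b \<or> x = b \<and> y < a)" if ba: "b < a"
  proof (cases "(a, b) \<in> O0")
    case True
    then show ?thesis using good ba by (auto simp: good_def)
  next
    case False
    then have f: "F\<^sup>*\<^sup>* (i, j) (a, b)" using cases by blast
    have "N b a" using Nab sym_N by (rule sympD[rotated])
    then have "\<not> (b < i \<or> b = i \<and> a < j)"
      using dec ba False swap[OF f] by (auto simp: decided_def)
    moreover have "\<not> (b = i \<and> a = j)" using f not_forces_swap_interval_graph[OF G ij(1)] by blast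
    ultimately have "i < b \<or> i = b \<and> j < a" by linarith
    then show ?thesis using forces_rtranclp_sym[OF f sym_N] ij(2) by blast
  qed
  ultimately show "N a b \<and> (b, a) \<notin> O' \<and>
     (b < a \<longrightarrow> (\<exists>x y. F\<^sup>*\<^sup>* (a, b) (x, y) \<and> x < y \<and> (x < b \<or> x = b \<and> y < a)))"
    using Nab by blast
qed

lemma lex_orientation_final:
  assumes "good O'" "closed O'" "decided n 0 O'"
  shows "lex_orientation N (\<lambda>a b. (a, b) \<in> O')"
proof
  fix a b assume N: "N a b"
  then have "N b a" by (rule sympD[OF sym_N])
  moreover have "a < b \<or> b < a" "a < n" "b < n" using N by (auto simp: nonadjacent_def)
  ultimately show "(a, b) \<in> O' \<or> (b, a) \<in> O'"
    using N assms(3) unfolding decided_def by blast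
next
  fix a b assume "(a, b) \<in> O'"
  then show "N a b" "(b, a) \<notin> O'" using assms(1) unfolding good_def by blast+
  fix c d assume "F (a, b) (c, d)"
  then show "(c, d) \<in> O'" using \<open>(a, b) \<in> O'\<close> assms(2) unfolding closed_def by blast
next
  fix a b assume "(a, b) \<in> O'" "b < a"
  then show "\<exists>x y. F\<^sup>*\<^sup>* (a, b) (x, y) \<and> x < y \<and> (x < b \<or> x = b \<and> y < a)"
    using assms(1) unfolding good_def by blast
qed (rule sym_N)

text \<open>Popping only moves the head, so the cells list all arcs oriented so far. As the tail is
  \<open>card O'\<close>, no arc is listed twice.\<close>

definition queue :: "(nat \<times> nat) set \<Rightarrow> store \<Rightarrow> bool" where
  "queue O' s \<longleftrightarrow> base s \<and> arcs O' \<and> mat arc_at n n (\<lambda>a b. of_bool ((a, b) \<in> O')) s \<and>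
     nmem s q_tail 0 = card O' \<and> (\<lambda>q. (nmem s q_src q, nmem s q_tgt q)) ` {..<card O'} = O'"

definition processed :: "nat \<Rightarrow> (nat \<times> nat) set \<Rightarrow> store \<Rightarrow> bool" where
  "processed h O' s \<longleftrightarrow> h \<le> card O' \<and>
     (\<forall>q<h. \<forall>y. F (nmem s q_src q, nmem s q_tgt q) y \<longrightarrow> y \<in> O')"

definition pushed :: "nat \<Rightarrow> nat \<Rightarrow> store \<Rightarrow> store" where
  "pushed a b s = nupd q_tail 0 (Suc (nmem s q_tail 0)) (nupd q_tgt (nmem s q_tail 0) b
     (nupd q_src (nmem s q_tail 0) a (nupd arc_at (a * n + b) 1 s)))"

lemma nmem_pushed [simp]:
  "x \<noteq> q_tail \<Longrightarrow> x \<noteq> q_tgt \<Longrightarrow> x \<noteq> q_src \<Longrightarrow> x \<noteq> arc_at \<Longrightarrow> nmem (pushed a b s) x i = nmem s x i"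
  by (simp add: pushed_def)

lemma queue_nupd [simp]:
  "x \<noteq> 0 \<Longrightarrow> x \<noteq> 1 \<Longrightarrow> x \<noteq> 3 \<Longrightarrow> x \<noteq> q_tail \<Longrightarrow> x \<noteq> q_tgt \<Longrightarrow> x \<noteq> q_src \<Longrightarrow> x \<noteq> arc_at \<Longrightarrow>
    queue O' (nupd x i v s) = queue O' s"
  by (simp add: queue_def)

lemma processed_nupd [simp]:
  "x \<noteq> q_tgt \<Longrightarrow> x \<noteq> q_src \<Longrightarrow> processed h O' (nupd x i v s) = processed h O' s"
  by (simp add: processed_def)

lemma queue_base: "queue O' s \<Longrightarrow> base s"
  and queue_arcs: "queue O' s \<Longrightarrow> arcs O'"
  and queue_tail: "queue O' s \<Longrightarrow> nmem s q_tail 0 = card O'"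
  by (simp_all add: queue_def)

lemma queue_arc:
  "queue O' s \<Longrightarrow> a < n \<Longrightarrow> b < n \<Longrightarrow> nmem s arc_at (a * n + b) = of_bool ((a, b) \<in> O')"
  using mat_get[of arc_at n n "\<lambda>a b. of_bool ((a, b) \<in> O')" s a b] by (simp add: queue_def)

lemma queue_pushed:
  assumes q: "queue O' s" and new: "(a, b) \<notin> O'" and N: "N a b"
  shows "queue (insert (a, b) O') (pushed a b s)"
proof -
  let ?s = "pushed a b s" and ?t = "card O'"
  note [simp] = queue_base[OF q] queue_tail[OF q]
  have card: "card (insert (a, b) O') = Suc ?t"
    using new arcs_finite[OF queue_arcs[OF q]] by simp
  have "(\<lambda>q. (nmem ?s q_src q, nmem ?s q_tgt q)) ` {..<?t} =
    (\<lambda>q. (nmem s q_src q, nmem s q_tgt q)) ` {..<?t}"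
    using q by (intro image_cong) (auto simp: pushed_def)
  also have "\<dots> = O'" using q by (simp add: queue_def)
  finally have "(\<lambda>q. (nmem ?s q_src q, nmem ?s q_tgt q)) ` {..<Suc ?t} = insert (a, b) O'"
    using q by (simp add: lessThan_Suc) (simp add: pushed_def)
  moreover have "mat arc_at n n (\<lambda>u v. of_bool ((u, v) \<in> insert (a, b) O')) (nupd arc_at (a * n + b) 1 s)"
    by (rule mat_update[where f = "\<lambda>u v. of_bool ((u, v) \<in> O')"])
      (use q N in \<open>auto simp: queue_def nonadjacent_def\<close>)
  then have "mat arc_at n n (\<lambda>u v. of_bool ((u, v) \<in> insert (a, b) O')) ?s"
    by (simp add: pushed_def)
  moreover have "arcs (insert (a, b) O')" using queue_arcs[OF q] N by (auto simp: arcs_def)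
  moreover have "base ?s" "nmem ?s q_tail 0 = Suc ?t" using q by (simp_all add: pushed_def)
  ultimately show ?thesis unfolding queue_def card by blast
qed

lemma processed_pushed:
  assumes "processed h O' s" "queue O' s" "(a, b) \<notin> O'"
  shows "processed h (insert (a, b) O') (pushed a b s)"
  using assms arcs_finite[OF queue_arcs[OF assms(2)]] queue_tail[OF assms(2)]
  by (auto simp: processed_def pushed_def)

lemma wp_push:
  assumes "base s" "nmem s x 0 \<le> n"
    and "x \<notin> {q_tail, q_tgt, q_src, arc_at}" "y \<notin> {q_tail, q_tgt, q_src, arc_at}"
  shows "wp (push x y) Q s k \<longleftrightarrow> Q (pushed (nmem s x 0) (nmem s y 0) s) (Suc (Suc (Suc (Suc k))))"
  using assms by (simp add: push_def wp_simps pushed_def)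

text \<open>State while the neighbours of the arc \<open>(a, b)\<close> at position \<open>h\<close> of the queue are scanned:
  \<open>e\<close> is the seed of the current class and \<open>O0\<close> the set of arcs decided before.\<close>

definition scanning :: "(nat \<times> nat) set \<Rightarrow> nat \<times> nat \<Rightarrow> nat \<Rightarrow> nat \<Rightarrow> nat \<Rightarrow> (nat \<times> nat) set \<Rightarrow> store \<Rightarrow> bool" where
  "scanning O0 e h a b O' s \<longleftrightarrow> queue O' s \<and> spread O0 e O' \<and> processed h O' s \<and> h < card O' \<and>
     nmem s q_src h = a \<and> nmem s q_tgt h = b \<and> nmem s vA 0 = a \<and> nmem s vB 0 = b \<and>
     nmem s vI 0 = fst e \<and> nmem s vJ 0 = snd e \<and> nmem s q_head 0 = Suc h"

lemma scanning_queue: "scanning O0 e h a b O' s \<Longrightarrow> queue O' s"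
  by (simp add: scanning_def)

lemma scanning_vK [simp]: "scanning O0 e h a b O' (nupd vK i v s) = scanning O0 e h a b O' s"
  by (simp add: scanning_def)

lemma scanning_arc: "scanning O0 e h a b O' s \<Longrightarrow> (a, b) \<in> O'"
  by (auto simp: scanning_def queue_def)

lemma scanning_N: "scanning O0 e h a b O' s \<Longrightarrow> N a b"
  using scanning_arc queue_arcs[OF scanning_queue] by (auto simp: arcs_def)

lemma scanning_pushed:
  assumes sc: "scanning O0 e h a b O' s" and cl: "closed O0"
    and f: "F (a, b) (x, y)" and new: "(x, y) \<notin> O'"
  shows "scanning O0 e h a b (insert (x, y) O') (pushed x y s)"
proof -
  have q: "queue O' s" using sc by (rule scanning_queue)
  have "N x y" using f by (auto elim: forces.cases)
  moreover have "card (insert (x, y) O') = Suc (card O')"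
    using new arcs_finite[OF queue_arcs[OF q]] by simp
  moreover have "nmem (pushed x y s) q_src h = a" "nmem (pushed x y s) q_tgt h = b"
    using sc queue_tail[OF q] by (auto simp: pushed_def scanning_def)
  ultimately show ?thesis
    using sc queue_pushed[OF q new] processed_pushed[OF _ q new] spread_step[OF cl _ scanning_arc[OF sc] f]
    by (auto simp: scanning_def)
qed

text \<open>Passing on some \<open>O1\<close> above \<open>O'\<close> merges both outcomes of the
  test. The five steps are the guard and the four assignments of \<open>push\<close>.\<close>

lemma wp_cond_push:
  assumes sc: "scanning O0 e h a b O' s" and cl: "closed O0"
    and x: "nmem s vx 0 = x" "vx \<notin> {q_tail, q_tgt, q_src, arc_at}"
    and y: "nmem s vy 0 = y" "vy \<notin> {q_tail, q_tgt, q_src, arc_at}"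
    and test: "bval s t \<Longrightarrow> F (a, b) (x, y) \<and> (x, y) \<notin> O'"
    and test': "F (a, b) (x, y) \<Longrightarrow> (x, y) \<notin> O' \<Longrightarrow> bval s t"
    and Q: "\<And>s' O1 k'. scanning O0 e h a b O1 s' \<Longrightarrow> O' \<subseteq> O1 \<Longrightarrow>
      (F (a, b) (x, y) \<longrightarrow> (x, y) \<in> O1) \<Longrightarrow> nmem s' vK 0 = nmem s vK 0 \<Longrightarrow> k' \<le> k + 5 \<Longrightarrow> Q s' k'"
  shows "wp (Cond t (push vx vy) Skip) Q s k"
proof (cases "bval s t")
  case True
  then have f: "F (a, b) (x, y)" "(x, y) \<notin> O'" using test by auto
  have "x \<le> n" using f(1) by (auto elim!: forces.cases simp: nonadjacent_def)
  then have "wp (push vx vy) Q s (Suc k) \<longleftrightarrow> Q (pushed x y s) (Suc (Suc (Suc (Suc (Suc k)))))"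
    using queue_base[OF scanning_queue[OF sc]] x y by (subst wp_push) auto
  then show ?thesis
    using True Q[OF scanning_pushed[OF sc cl f]] by (simp add: wp_simps subset_insertI)
next
  case False
  then have "F (a, b) (x, y) \<longrightarrow> (x, y) \<in> O'" using test' by blast
  then show ?thesis using False Q[OF sc subset_refl _ refl] by (simp add: wp_simps)
qed

text \<open>The case \<open>c = a\<close> is an arc forcing itself. The program's test rejects it,
  which is harmless because \<open>(a, b)\<close> is already marked.\<close>

lemma forces_tail_iff:
  assumes "N a b" "c < n"
  shows "F (a, b) (c, b) \<longleftrightarrow> {a, c} \<in> E \<and> {c, b} \<notin> E \<or> c = a"
  using assms no_loop by (auto simp: forces.simps nonadjacent_def)

lemma forces_head_iff:
  assumes "N a b" "c < n"
  shows "F (a, b) (a, c) \<longleftrightarrow> {b, c} \<in> E \<and> {a, c} \<notin> E \<or> c = b"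
  using assms no_loop by (auto simp: forces.simps nonadjacent_def insert_commute)

lemma scanning_reads:
  assumes sc: "scanning O0 e h a b O' s" and c: "c < n"
  shows "nmem s 0 0 = n" "nmem s vA 0 = a" "nmem s vB 0 = b"
    "nmem s 3 a = a * n" "nmem s 3 b = b * n" "nmem s 3 c = c * n"
    "nmem s 1 (a * n + c) = of_bool ({a, c} \<in> E)"
    "nmem s 1 (b * n + c) = of_bool ({b, c} \<in> E)"
    "nmem s 1 (c * n + b) = of_bool ({c, b} \<in> E)"
    "nmem s arc_at (c * n + b) = of_bool ((c, b) \<in> O')"
    "nmem s arc_at (a * n + c) = of_bool ((a, c) \<in> O')"
proof -
  have q: "queue O' s" using sc by (rule scanning_queue)
  have b: "base s" using q by (rule queue_base)
  have "a < n" "b < n" using scanning_N[OF sc] by (auto simp: nonadjacent_def)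
  with b c show "nmem s 0 0 = n" "nmem s 3 a = a * n" "nmem s 3 b = b * n" "nmem s 3 c = c * n"
    "nmem s 1 (a * n + c) = of_bool ({a, c} \<in> E)"
    "nmem s 1 (b * n + c) = of_bool ({b, c} \<in> E)"
    "nmem s 1 (c * n + b) = of_bool ({c, b} \<in> E)"
    by (simp_all add: base_adj del: One_nat_def)
  show "nmem s arc_at (c * n + b) = of_bool ((c, b) \<in> O')"
    "nmem s arc_at (a * n + c) = of_bool ((a, c) \<in> O')"
    using queue_arc[OF q] \<open>a < n\<close> \<open>b < n\<close> c by auto
  show "nmem s vA 0 = a" "nmem s vB 0 = b" using sc by (auto simp: scanning_def)
qed

lemma wp_scan:
  assumes sc: "scanning O0 e h a b O' s" and cl: "closed O0"
    and Q: "\<And>s' O1 k'. scanning O0 e h a b O1 s' \<Longrightarrow> (\<forall>y. F (a, b) y \<longrightarrow> y \<in> O1) \<Longrightarrow>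
      k' \<le> k + 12 * n + 2 \<Longrightarrow> Q s' k'"
  shows "wp scan_prog Q s k"
  unfolding scan_prog_def
\<comment> \<open>Twelve steps per vertex: guard, increment and two conditional pushes of at most
  five steps.\<close>
proof (rule wp_For[where m = n and I = "\<lambda>c s k'. k' \<le> k + 1 + 12 * c \<and>
    (\<exists>O1. scanning O0 e h a b O1 s \<and>
      (\<forall>c'<c. (F (a, b) (c', b) \<longrightarrow> (c', b) \<in> O1) \<and> (F (a, b) (a, c') \<longrightarrow> (a, c') \<in> O1)))"],
    goal_cases)
  case 1
  show ?case using sc by auto
next
  case (2 c s1 k1)
  then obtain O1 where sc1: "scanning O0 e h a b O1 s1"
    and scanned: "\<forall>c'<c. (F (a, b) (c', b) \<longrightarrow> (c', b) \<in> O1) \<and> (F (a, b) (a, c') \<longrightarrow> (a, c') \<in> O1)"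
    by blast
  have N: "N a b" using scanning_N[OF sc1] .
  note c = \<open>c < n\<close> \<open>nmem s1 vK 0 = c\<close>
  note reads1 = scanning_reads[OF sc1 c(1)]
  show ?case
    unfolding wp_Seq
  proof (rule wp_cond_push[OF sc1 cl, where x = c and y = b], goal_cases)
    case 5
    then have "{a, c} \<in> E \<and> {c, b} \<notin> E \<and> (c, b) \<notin> O1"
      by (simp add: reads1 c del: One_nat_def)
    then show ?case using forces_tail_iff[OF N c(1)] by blast
  next
    case 6
    then have "{a, c} \<in> E \<and> {c, b} \<notin> E \<and> (c, b) \<notin> O1"
      using forces_tail_iff[OF N c(1)] scanning_arc[OF sc1] by blast
    then show ?case by (simp add: reads1 c del: One_nat_def)
  next
    case (7 s2 O2 k2)
    note sc2 = 7(1)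
    have c2: "nmem s2 vK 0 = c" using 7 c by simp
    note reads2 = scanning_reads[OF sc2 c(1)]
    show ?case
    proof (rule wp_cond_push[OF sc2 cl, where x = a and y = c], goal_cases)
      case 5
      then have "{b, c} \<in> E \<and> {a, c} \<notin> E \<and> (a, c) \<notin> O2"
        by (simp add: reads2 c2 del: One_nat_def)
      then show ?case using forces_head_iff[OF N c(1)] by blast
    next
      case 6
      then have "{b, c} \<in> E \<and> {a, c} \<notin> E \<and> (a, c) \<notin> O2"
        using forces_head_iff[OF N c(1)] scanning_arc[OF sc2] by blast
      then show ?case by (simp add: reads2 c2 del: One_nat_def)
    next
      case (7 s3 O3 k3)
      have "(F (a, b) (c', b) \<longrightarrow> (c', b) \<in> O3) \<and> (F (a, b) (a, c') \<longrightarrow> (a, c') \<in> O3)" if "c' < Suc c" for c'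
        using that scanned 7 \<open>O1 \<subseteq> O2\<close> \<open>F (a, b) (c, b) \<longrightarrow> (c, b) \<in> O2\<close> by (auto simp: less_Suc_eq)
      moreover have "Suc k3 \<le> k + 1 + 12 * Suc c"
        using 7(5) \<open>k2 \<le> Suc k1 + 5\<close> 2(3) by simp
      ultimately show ?case using 7 c2 by auto
    qed (simp_all add: reads2 c2)
  qed (simp_all add: reads1 c)
next
  case (3 c s1 k1)
  then obtain O1 where "scanning O0 e h a b O1 s1" by blast
  then have "base s1" by (rule queue_base[OF scanning_queue])
  then show ?case by simp
next
  case (4 s1 k1)
  then obtain O1 where sc1: "scanning O0 e h a b O1 s1"
    and scanned: "\<forall>c'<n. (F (a, b) (c', b) \<longrightarrow> (c', b) \<in> O1) \<and> (F (a, b) (a, c') \<longrightarrow> (a, c') \<in> O1)"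
    by blast
  have "y \<in> O1" if "F (a, b) y" for y
  proof -
    have "\<exists>c<n. y = (c, b) \<or> y = (a, c)" using that by cases (auto simp: nonadjacent_def)
    then show ?thesis using that scanned by blast
  qed
  then show ?case using sc1 4 Q[of O1 s1 "Suc k1"] by auto
qed

text \<open>An amortised bound: the arcs between the old head and the final tail pay for the loop.
  Summed over all seeds this telescopes to the final number of arcs.\<close>

lemma wp_drain:
  assumes q: "queue O1 s" and sp: "spread O0 (i, j) O1" and pr: "processed (nmem s q_head 0) O1 s"
    and v: "nmem s vI 0 = i" "nmem s vJ 0 = j" and cl: "closed O0"
    and Q: "\<And>s' O2 k'. queue O2 s' \<Longrightarrow> spread O0 (i, j) O2 \<Longrightarrow> closed O2 \<Longrightarrow>
      nmem s' q_head 0 = card O2 \<Longrightarrow> nmem s' vI 0 = i \<Longrightarrow> nmem s' vJ 0 = j \<Longrightarrow>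
      k' + nmem s q_head 0 * (12 * n + 6) \<le> k + card O2 * (12 * n + 6) + 1 \<Longrightarrow> Q s' k'"
  shows "wp (Loop (NLess (var q_head) (var q_tail)) pop_prog) Q s k"
proof -
  \<comment> \<open>The price of one arc: \<open>12 * n + 2\<close> for the scan, three assignments
    and the loop guard.\<close>
  let ?c = "12 * n + 6"
  let ?I = "\<lambda>s1 k1. \<exists>O'. queue O' s1 \<and> spread O0 (i, j) O' \<and> processed (nmem s1 q_head 0) O' s1 \<and>
    nmem s1 vI 0 = i \<and> nmem s1 vJ 0 = j \<and>
    k1 + nmem s q_head 0 * ?c \<le> k + nmem s1 q_head 0 * ?c"
  show ?thesis
  proof (rule wp_Loop[where I = ?I and m = "\<lambda>s. n * n - nmem s q_head 0"])
    show "?I s k" using q sp pr v by auto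
  next
    fix s1 k1 assume I: "?I s1 k1" and b: "bval s1 (NLess (var q_head) (var q_tail))"
    define h where "h = nmem s1 q_head 0"
    obtain O' where O': "queue O' s1" "spread O0 (i, j) O'" "processed h O' s1"
      "nmem s1 vI 0 = i" "nmem s1 vJ 0 = j" "k1 + nmem s q_head 0 * ?c \<le> k + h * ?c"
      using I unfolding h_def by blast
    define a b where "a = nmem s1 q_src h" and "b = nmem s1 q_tgt h"
    have lt: "h < card O'" using b queue_tail[OF O'(1)] by (simp add: h_def)
    let ?s = "nupd q_head 0 (Suc h) (nupd vB 0 b (nupd vA 0 a s1))"
    have sc: "scanning O0 (i, j) h a b O' ?s"
      using O' lt by (simp add: scanning_def a_def b_def)
    have "wp scan_prog (\<lambda>s' k'. ?I s' k' \<and> n * n - nmem s' q_head 0 < n * n - nmem s1 q_head 0)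
        ?s (k1 + 4)"
    proof (rule wp_scan[OF sc cl])
      fix s' O1 k'
      assume sc': "scanning O0 (i, j) h a b O1 s'" and all: "\<forall>y. F (a, b) y \<longrightarrow> y \<in> O1"
        and k': "k' \<le> k1 + 4 + 12 * n + 2"
      have "processed (Suc h) O1 s'"
        using sc' all unfolding processed_def scanning_def by (auto simp: less_Suc_eq)
      moreover have "k' + nmem s q_head 0 * ?c \<le> k + Suc h * ?c" using k' O'(6) by simp
      moreover have "card O1 \<le> n * n" using card_arcs queue_arcs scanning_queue[OF sc'] by blast
      then have "n * n - Suc h < n * n - h" using sc' by (auto simp: scanning_def)
      ultimately show "?I s' k' \<and> n * n - nmem s' q_head 0 < n * n - nmem s1 q_head 0"
        using sc' by (auto simp: scanning_def h_def)
    qed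
    then show "wp pop_prog (\<lambda>s' k'. ?I s' k' \<and> n * n - nmem s' q_head 0 < n * n - nmem s1 q_head 0)
        s1 (Suc k1)"
      by (simp add: pop_prog_def wp_simps a_def b_def h_def eval_nat_numeral)
  next
    fix s1 k1 assume I: "?I s1 k1" and b: "\<not> bval s1 (NLess (var q_head) (var q_tail))"
    obtain O' where O': "queue O' s1" "spread O0 (i, j) O'" "processed (nmem s1 q_head 0) O' s1"
      "nmem s1 vI 0 = i" "nmem s1 vJ 0 = j"
      "k1 + nmem s q_head 0 * ?c \<le> k + nmem s1 q_head 0 * ?c"
      using I by blast
    have h: "nmem s1 q_head 0 = card O'"
      using b O'(3) queue_tail[OF O'(1)] by (simp add: processed_def)
    have "closed O'"
      unfolding closed_def
    proof (intro allI impI)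
      fix x y assume "x \<in> O'" "F x y"
      moreover have "O' = (\<lambda>q. (nmem s1 q_src q, nmem s1 q_tgt q)) ` {..<card O'}"
        using O'(1) by (simp add: queue_def)
      ultimately obtain q where "q < card O'" "x = (nmem s1 q_src q, nmem s1 q_tgt q)" by blast
      then show "y \<in> O'" using O'(3) \<open>F x y\<close> unfolding processed_def h by blast
    qed
    then show "Q s1 (Suc k1)" using Q[OF O'(1,2)] O' h by simp
  qed
qed

definition oriented :: "nat \<Rightarrow> nat \<Rightarrow> (nat \<times> nat) set \<Rightarrow> store \<Rightarrow> bool" where
  "oriented i j O' s \<longleftrightarrow> queue O' s \<and> good O' \<and> closed O' \<and> decided i j O' \<and>
     nmem s q_head 0 = card O'"

lemma oriented_nupd [simp]:
  "x \<noteq> 0 \<Longrightarrow> x \<noteq> 1 \<Longrightarrow> x \<noteq> 3 \<Longrightarrow> x \<noteq> q_tail \<Longrightarrow> x \<noteq> q_tgt \<Longrightarrow> x \<noteq> q_src \<Longrightarrow> x \<noteq> arc_at \<Longrightarrow>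
    x \<noteq> q_head \<Longrightarrow> oriented i j O' (nupd x y v s) = oriented i j O' s"
  by (simp add: oriented_def)

lemma decided_Suc:
  "decided i j O' \<Longrightarrow> (N i j \<Longrightarrow> i < j \<Longrightarrow> (i, j) \<in> O' \<or> (j, i) \<in> O') \<Longrightarrow> decided i (Suc j) O'"
  unfolding decided_def by (metis less_Suc_eq)

lemma decided_mono: "decided i j O' \<Longrightarrow> O' \<subseteq> O1 \<Longrightarrow> decided i j O1"
  unfolding decided_def by blast

lemma decided_next_row: "decided i n O' \<Longrightarrow> decided (Suc i) 0 O'"
  unfolding decided_def by (metis less_Suc_eq nonadjacent_def not_less0)

text \<open>Beyond what the new arcs pay, six steps remain: the test, four for \<open>push\<close>,
  and the last guard of the inner loop.\<close>

lemma wp_orient_pair: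
  assumes o: "oriented i j O0 s" and v: "nmem s vI 0 = i" "nmem s vJ 0 = j" and lt: "i < n" "j < n"
    and Q: "\<And>s' O' k'. oriented i (Suc j) O' s' \<Longrightarrow> nmem s' vI 0 = i \<Longrightarrow> nmem s' vJ 0 = j \<Longrightarrow>
      k' + card O0 * (12 * n + 6) \<le> k + card O' * (12 * n + 6) + 6 \<Longrightarrow> Q s' k'"
  shows "wp (Cond (Conj (Conj (NLess (var vI) (var vJ)) (NLess (NGet 1 (ind (var vI) (var vJ))) (NConst 1)))
           (Conj (NLess (NGet arc_at (ind (var vI) (var vJ))) (NConst 1))
             (NLess (NGet arc_at (ind (var vJ) (var vI))) (NConst 1))))
         (Seq (push vI vJ) (Loop (NLess (var q_head) (var q_tail)) pop_prog)) Skip) Q s k"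
    (is "wp (Cond ?t _ _) Q s k")
proof -
  have q: "queue O0 s" and good: "good O0" and cl: "closed O0" and dec: "decided i j O0"
    and h: "nmem s q_head 0 = card O0"
    using o by (auto simp: oriented_def)
  have base: "base s" using q by (rule queue_base)
  have t: "bval s ?t \<longleftrightarrow> i < j \<and> {i, j} \<notin> E \<and> (i, j) \<notin> O0 \<and> (j, i) \<notin> O0"
    using base v lt by (simp add: base_adj queue_arc[OF q] del: One_nat_def)
  show ?thesis
  proof (cases "bval s ?t")
    case True
    then have ij: "i < j" "(i, j) \<notin> O0" "(j, i) \<notin> O0" and N: "N i j"
      using t lt by (auto simp: nonadjacent_def)
    let ?s = "pushed i j s" and ?O = "insert (i, j) O0"
    \<comment> \<open>Closedness of \<open>O0\<close> makes all earlier entries processed, so the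
      queue can be continued instead of restarted.\<close>
    have "processed (card O0) O0 s"
      using cl q unfolding processed_def closed_def queue_def by blast
    then have pr: "processed (nmem ?s q_head 0) ?O ?s"
      using processed_pushed[OF _ q ij(2)] h by simp
    have "wp (Loop (NLess (var q_head) (var q_tail)) pop_prog) Q ?s (k + 5)"
    proof (rule wp_drain[OF queue_pushed[OF q ij(2) N] spread_refl pr _ _ cl])
      fix s' O2 k'
      assume a: "queue O2 s'" "spread O0 (i, j) O2" "closed O2" "nmem s' q_head 0 = card O2"
        "nmem s' vI 0 = i" "nmem s' vJ 0 = j"
        "k' + nmem ?s q_head 0 * (12 * n + 6) \<le> k + 5 + card O2 * (12 * n + 6) + 1"
      have sub: "insert (i, j) O0 \<subseteq> O2" using a(2) by (simp add: spread_def)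
      have "decided i (Suc j) O2"
        using decided_Suc[OF decided_mono[OF dec]] sub by blast
      then have "oriented i (Suc j) O2 s'"
        using a spread_good[OF good cl dec N ij a(2)] by (simp add: oriented_def)
      then show "Q s' k'" using Q a h by simp
    qed (use v in auto)
    then show ?thesis
      using True wp_push[OF base, of vI vJ] v lt by (simp add: wp_simps eval_nat_numeral)
  next
    case False
    have "(i, j) \<in> O0 \<or> (j, i) \<in> O0" if "N i j" "i < j"
      using False t that by (auto simp: nonadjacent_def)
    then have "oriented i (Suc j) O0 s"
      using o decided_Suc[OF dec] by (auto simp: oriented_def)
    then have "Q s (Suc (Suc k))" by (rule Q) (use v in auto)
    then show ?thesis using False by (simp only: wp_Cond wp_Skip if_False)
  qed
qed

lemma wp_orient:
  assumes s: "base s" "mat arc_at n n (\<lambda>_ _. 0) s"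
    and Q: "\<And>s' L k'. base s' \<Longrightarrow> lex_orientation N L \<Longrightarrow> mat arc_at n n (\<lambda>a b. of_bool (L a b)) s' \<Longrightarrow>
      k' \<le> k + n * (8 * n + 4) + n * n * (12 * n + 6) + 4 \<Longrightarrow> Q s' k'"
  shows "wp orient_prog Q s k"
  unfolding orient_prog_def wp_Seq wp_NSet
proof (rule wp_For[where m = n and I = "\<lambda>i s k'. \<exists>O'. oriented i 0 O' s \<and>
    k' \<le> k + 3 + i * (8 * n + 4) + card O' * (12 * n + 6)"], goal_cases)
  case 1
  show ?case
    using s by (auto simp: oriented_def queue_def arcs_def good_def closed_def decided_def
        intro!: exI[of _ "{}"])
next
  case (2 i s1 k1)
  then obtain O1 where O1: "oriented i 0 O1 s1" "k1 \<le> k + 3 + i * (8 * n + 4) + card O1 * (12 * n + 6)"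
    by blast
  show ?case
  proof (rule wp_For[where m = n and I = "\<lambda>j s k'. nmem s vI 0 = i \<and> (\<exists>O'. oriented i j O' s \<and>
      k' + card O1 * (12 * n + 6) \<le> k1 + 2 + j * 8 + card O' * (12 * n + 6))"], goal_cases)
    case (2 j s2 k2)
    then obtain O2 where O2: "oriented i j O2 s2"
      "k2 + card O1 * (12 * n + 6) \<le> k1 + 2 + j * 8 + card O2 * (12 * n + 6)" by blast
    show ?case
    proof (rule wp_orient_pair[OF O2(1)])
      fix s' O' k'
      assume "oriented i (Suc j) O' s'" "nmem s' vI 0 = i" "nmem s' vJ 0 = j"
        "k' + card O2 * (12 * n + 6) \<le> Suc k2 + card O' * (12 * n + 6) + 6"
      then show "nmem s' vJ 0 = j \<and> nmem (nupd vJ 0 (Suc j) s') vI 0 = i \<and>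
          (\<exists>O'. oriented i (Suc j) O' (nupd vJ 0 (Suc j) s') \<and>
            Suc k' + card O1 * (12 * n + 6) \<le> k1 + 2 + Suc j * 8 + card O' * (12 * n + 6))"
        using O2(2) by (auto intro!: exI[of _ O'])
    qed (use 2 \<open>i < n\<close> in auto)
  next
    case (3 j s2 k2)
    then obtain O2 where "queue O2 s2" by (auto simp: oriented_def)
    then show ?case using base_n[OF queue_base] by simp
  next
    case (4 s2 k2)
    then obtain O2 where O2: "oriented i n O2 s2"
      "k2 + card O1 * (12 * n + 6) \<le> k1 + 2 + n * 8 + card O2 * (12 * n + 6)" by blast
    have "oriented (Suc i) 0 O2 s2" using O2(1) decided_next_row by (simp add: oriented_def)
    then show ?case using 4 O2(2) O1(2) by (auto intro!: exI[of _ O2])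
  qed (use 2 O1 in auto)
next
  case (3 i s1 k1)
  then obtain O1 where "queue O1 s1" by (auto simp: oriented_def)
  then show ?case using base_n[OF queue_base] by simp
next
  case (4 s1 k1)
  then obtain O1 where O1: "oriented n 0 O1 s1"
    "k1 \<le> k + 3 + n * (8 * n + 4) + card O1 * (12 * n + 6)" by blast
  then have q: "queue O1 s1" by (simp add: oriented_def)
  have "card O1 * (12 * n + 6) \<le> n * n * (12 * n + 6)"
    using card_arcs[OF queue_arcs[OF q]] by (rule mult_right_mono) simp
  then have "Suc k1 \<le> k + n * (8 * n + 4) + n * n * (12 * n + 6) + 4" using O1(2) by linarith
  then show ?case
    using O1 q by (intro Q[where L = "\<lambda>a b. (a, b) \<in> O1"])
      (auto simp: oriented_def queue_def lex_orientation_final)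
qed

end

section \<open>Composition of the phases and total running time\<close>

definition main_prog :: com where
  "main_prog = Seq rows_prog (Seq orient_prog (Seq lo_prog (Seq hi_prog
     (Seq cnt_prog (Seq opt_prog label_prog)))))"

definition main_time :: "nat \<Rightarrow> nat" where
  "main_time n = (4 * n + 7) + (n * (8 * n + 4) + n * n * (12 * n + 6) + 4) + (n * (3 * n + 7) + 2) +
     (n * (4 * n + 7) + 2) + (Suc n * (Suc n * (4 * n + 7) + 4) + 2) +
     (Suc n * (Suc n * (7 * n + 9) + 5) + 2) + (n * (4 * n + 8) + 2)"

lemma main_time_bigo: "(\<lambda>n. real (main_time n)) \<in> O(\<lambda>n. real n ^ 3)"
proof (rule bigoI)
  \<comment> \<open>214 is the sum of the coefficients 23, 63, 82 and 46 of the expanded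
    polynomial.\<close>
  show "\<forall>\<^sub>F n in sequentially. norm (real (main_time n)) \<le> 214 * norm (real n ^ 3)"
    using eventually_ge_at_top[of 1]
  proof eventually_elim
    case (elim n)
    then have "n \<le> n ^ 3" "n ^ 2 \<le> n ^ 3" "1 \<le> n ^ 3"
      using power_increasing[of 1 3 n] power_increasing[of 2 3 n] by auto
    moreover have "main_time n = 23 * n ^ 3 + 63 * n ^ 2 + 82 * n + 46"
      by (simp add: main_time_def power3_eq_cube power2_eq_square algebra_simps)
    ultimately have "main_time n \<le> 214 * n ^ 3" by linarith
    then have "real (main_time n) \<le> real (214 * n ^ 3)" by (rule of_nat_mono)
    then show ?case by simp
  qed
qed

lemma input_store_inp: "prog_store.inp n E p (input_store p n E)"
proof -
  have "a * n + b < n * n" if "a < n" "b < n" for a b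
  proof -
    have "a * n + b < Suc a * n" using that by simp
    also have "\<dots> \<le> n * n" using that by (intro mult_le_mono1) simp
    finally show ?thesis .
  qed
  then show ?thesis
    by (auto simp: prog_store.inp_def input_store_def cells_def)
qed

lemma (in prog_graph) wp_main:
  assumes p: "0 < p"
  shows "wp main_prog (\<lambda>s k. k \<le> main_time n \<and>
    max_p_mean_clique_partition p {..<n} E (output_partition n s)) (input_store p n E) 0"
  unfolding main_prog_def wp_Seq
proof (rule wp_rows[where f = "\<lambda>_ _. 0"])
  show "inp (input_store p n E)" by (rule input_store_inp)
  show "mat arc_at n n (\<lambda>_ _. 0) (input_store p n E)"
    by (simp add: cells_def input_store_def)
  fix s k
  assume s: "base s" "mat arc_at n n (\<lambda>_ _. 0) s" and k: "k \<le> 0 + 4 * n + 7"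
  show "wp orient_prog (wp lo_prog (wp hi_prog (wp cnt_prog (wp opt_prog (wp label_prog
    (\<lambda>s k. k \<le> main_time n \<and> max_p_mean_clique_partition p {..<n} E (output_partition n s))))))) s k"
    using s
  proof (rule wp_orient)
    fix s1 L k1
    assume s1: "base s1" "mat arc_at n n (\<lambda>a b. of_bool (L a b)) s1" and L: "lex_orientation N L"
      and k1: "k1 \<le> k + n * (8 * n + 4) + n * n * (12 * n + 6) + 4"
    have order: "interval_order n L" by (rule interval_order_lex_orientation[OF G L])
    interpret order: interval_order n L by fact
    let ?l = order.lo and ?r = order.hi
    have family: "interval_family n ?l ?r"
      by standard (simp_all add: order.lo_less_hi order.hi_le)
    interpret prog_intervals n E p ?l ?r
      using family by (simp add: prog_intervals_def)
    show "wp lo_prog (wp hi_prog (wp cnt_prog (wp opt_prog (wp label_prog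
      (\<lambda>s k. k \<le> main_time n \<and> max_p_mean_clique_partition p {..<n} E (output_partition n s)))))) s1 k1"
      using s1
    proof (rule wp_lo, fold order.lo_def)
      fix s2 k2
      assume s2: "base s2" "mat arc_at n n (\<lambda>a b. of_bool (L a b)) s2" "arr lo_at n ?l s2"
        and k2: "k2 \<le> k1 + n * (3 * n + 7) + 2"
      show "wp hi_prog (wp cnt_prog (wp opt_prog (wp label_prog
        (\<lambda>s k. k \<le> main_time n \<and> max_p_mean_clique_partition p {..<n} E (output_partition n s))))) s2 k2"
        using s2
      proof (rule wp_hi, fold order.hi_def)
        fix s3 k3
        assume s3: "base s3" "arr lo_at n ?l s3" "arr hi_at n ?r s3" and k3: "k3 \<le> k2 + n * (4 * n + 7) + 2"
        show "wp cnt_prog (wp opt_prog (wp label_prog (\<lambda>s k. k \<le> main_time n \<and>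
          max_p_mean_clique_partition p {..<n} E (output_partition n s)))) s3 k3"
          using s3
        proof (rule wp_cnt, fold bag_def)
          fix s4 k4
          assume s4: "base s4" "arr lo_at n ?l s4" "arr hi_at n ?r s4"
            "mat cnt_at (Suc n) (Suc n) (\<lambda>i j. card (bag i j)) s4"
            and k4: "k4 \<le> k3 + Suc n * (Suc n * (4 * n + 7) + 4) + 2"
          show "wp opt_prog (wp label_prog (\<lambda>s k. k \<le> main_time n \<and>
            max_p_mean_clique_partition p {..<n} E (output_partition n s))) s4 k4"
            using s4
          proof (rule wp_opt)
            fix s5 k5
            assume s5: "base s5" "arr lo_at n ?l s5" "arr hi_at n ?r s5"
              "cells ch_at (Suc n) (Suc n) 0 (\<lambda>m. choice_ok (n - m)) s5"
              and k5: "k5 \<le> k4 + Suc n * (Suc n * (7 * n + 9) + 5) + 2"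
            \<comment> \<open>The computed table itself becomes the choice function of the label
              recursion.\<close>
            define ch where "ch i j = nmem s5 ch_at ((n - i) * Suc n + j)" for i j
            have "choice_ok i j (ch i j)" if "i \<le> n" "j \<le> n" for i j
              using cells_get[OF s5(4), of "n - i" j] that by (simp add: ch_def)
            then interpret prog_labels n E p ?l ?r ch
              by unfold_locales (use p in \<open>auto simp: choice_ok_def\<close>)
            have "tables s5"
              using s5 by (simp add: tables_def cells_def ch_def ac_simps)
            then show "wp label_prog (\<lambda>s k. k \<le> main_time n \<and>
              max_p_mean_clique_partition p {..<n} E (output_partition n s)) s5 k5"
            proof (rule wp_label)
              fix s6 k6
              assume s6: "arr 2 n (label 0 n) s6" and k6: "k6 \<le> k5 + n * (4 * n + 8) + 2"
              have "output_partition n s6 = (\<lambda>v. {u. u < n \<and> label 0 n u = label 0 n v}) ` {..<n}"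
                unfolding output_partition_def using s6 by (intro image_cong) (auto simp: arr_def)
              moreover have "max_p_mean_clique_partition p {..<n} E
                ((\<lambda>v. {u. u < n \<and> label 0 n u = label 0 n v}) ` {..<n})"
              proof (rule output_max_p_mean_clique_partition[OF p L family])
                \<comment> \<open>Some stabbing assignment is required to instantiate the fact; left
                  end points provide one because intervals are nonempty.\<close>
                have "stabbing ?l {..<n}" using order.lo_less_hi by (simp add: stabbing_def)
                then show "stabbing (label 0 n) {..<n}" by (rule optimal_labelling(1))
              qed (use order.hi_le_lo_iff optimal_labelling(2) in auto)
              moreover have "k6 \<le> main_time n"
                using k k1 k2 k3 k4 k5 k6 unfolding main_time_def by linarith
              ultimately show "k6 \<le> main_time n \<and>
                max_p_mean_clique_partition p {..<n} E (output_partition n s6)" by simp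
            qed
          qed
        qed
      qed
    qed
  qed
qed

theorem theorem7:
  fixes p :: real
  assumes "p > 0"
  shows "solvable_in_time interval_graph (max_p_mean_clique_partition p) p (\<lambda>n. real n ^ 3)"
  unfolding solvable_in_time_def
proof (intro exI[of _ main_prog] exI[of _ main_time] conjI allI impI main_time_bigo)
  fix n :: nat and E :: "nat set set"
  assume G: "simple_graph {..<n} E \<and> interval_graph {..<n} E"
  interpret prog_graph n E p by standard (use G in blast)
  show "\<exists>t s. exec main_prog (input_store p n E) t s \<and> t \<le> main_time n \<and>
      max_p_mean_clique_partition p {..<n} E (output_partition n s)"
    using wp_main[OF assms] by (auto simp: wp_def)
qed

end
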